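(* Let $U$ be in class $\mathcal{K}^{+}$ on $[y_1,y_2]$ and $\beta\in(\min U'',\max U'')$. Let $(c,\alpha,\beta,\phi)$ be a non-resonant neutral mode, i.e. $c\in\mathbb{R}\setminus\mathrm{Ran}(U)$, $\alpha>0$ and $\phi$ is a nontrivial solution of $-\phi''+\alpha^2\phi-\frac{\beta-U''}{U-c}\phi=0$ on $(y_1,y_2)$, $\phi(y_1)=\phi(y_2)=0$. Then $\alpha^2=-\lambda_{n_0}(\beta,c)>0$ for some $n_0\ge1$ and $$\langle L_\alpha\omega_\alpha,\omega_\alpha\rangle=-(c-U_\beta)\frac{\partial\lambda_{n_0}}{\partial c}(\beta,c),$$ where $\omega_\alpha=-\phi''+\alpha^2\phi$.
   Context: Class $\mathcal{K}^+$: $U\in C^{3}([y_1,y_2])$ is not constant, and for each $\beta\in\mathrm{Ran}(U'')$ there exists $U_\beta\in\mathrm{Ran}(U)$ such that $K_\beta=\frac{\beta-U''}{U-U_\beta}$ is positive and bounded on $[y_1,y_2]$. $L_\alpha=\frac{1}{K_\beta}-\left(-\frac{d^2}{dy^2}+\alpha^2\right)^{-1}$ (Dirichlet inverse), $\langle f,g\rangle=\int_{y_1}^{y_2}f\bar g\,dy$. For $c\notin[U_{\min},U_{\max}]$, $\lambda_n(\beta,c)$ denotes the $n$-th eigenvalue of the regular Dirichlet Sturm–Liouville operator $-\frac{d^2}{dy^2}-\frac{\beta-U''}{U-c}$ on $(y_1,y_2)$. The paper's statement is implicitly normalized so that $\phi$ is an eigenfunction with $\|\phi\|_{L^2}=1$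 (as in the paper's normalization of eigenfunctions). *)

theory Defs
  imports "HOL-Analysis.Analysis"
begin

definition C3_on :: "real \<Rightarrow> real \<Rightarrow> (real \<Rightarrow> real) \<Rightarrow> (real \<Rightarrow> real) \<Rightarrow> (real \<Rightarrow> real) \<Rightarrow> (real \<Rightarrow> real) \<Rightarrow> bool" where
  "C3_on y1 y2 U U1 U2 U3 \<longleftrightarrow>
     (\<forall>y\<in>{y1..y2}. (U has_real_derivative U1 y) (at y within {y1..y2})
                 \<and> (U1 has_real_derivative U2 y) (at y within {y1..y2})
                 \<and> (U2 has_real_derivative U3 y) (at y within {y1..y2}))
     \<and> continuous_on {y1..y2} U3"

text \<open>Ub = U_beta in Ran(U), and K is K_beta = (beta - U'')/(U - U_beta),
  positive and bounded on [y1,y2] (K is the quotient wherever U \<noteq> U_beta).\<close>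
definition Kplus_witness :: "real \<Rightarrow> real \<Rightarrow> (real \<Rightarrow> real) \<Rightarrow> (real \<Rightarrow> real) \<Rightarrow> real \<Rightarrow> real \<Rightarrow> (real \<Rightarrow> real) \<Rightarrow> bool" where
  "Kplus_witness y1 y2 U U2 \<beta> Ub K \<longleftrightarrow>
     Ub \<in> U ` {y1..y2}
     \<and> (\<forall>y\<in>{y1..y2}. K y > 0 \<and> \<beta> - U2 y = K y * (U y - Ub))
     \<and> bounded (K ` {y1..y2})"

definition class_Kplus :: "real \<Rightarrow> real \<Rightarrow> (real \<Rightarrow> real) \<Rightarrow> (real \<Rightarrow> real) \<Rightarrow> (real \<Rightarrow> real) \<Rightarrow> (real \<Rightarrow> real) \<Rightarrow> bool" where
  "class_Kplus y1 y2 U U1 U2 U3 \<longleftrightarrow>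
     y1 < y2 \<and> C3_on y1 y2 U U1 U2 U3
     \<and> \<not> (\<forall>y\<in>{y1..y2}. U y = U y1)
     \<and> (\<forall>\<beta>\<in>U2 ` {y1..y2}. \<exists>Ub K. Kplus_witness y1 y2 U U2 \<beta> Ub K)"

definition dir_eigs :: "real \<Rightarrow> real \<Rightarrow> (real \<Rightarrow> real) \<Rightarrow> real set" where
  "dir_eigs y1 y2 q = {ev. \<exists>\<phi> \<phi>1 \<phi>2 :: real \<Rightarrow> real.
      (\<forall>y\<in>{y1..y2}. (\<phi> has_real_derivative \<phi>1 y) (at y within {y1..y2})
                 \<and> (\<phi>1 has_real_derivative \<phi>2 y) (at y within {y1..y2})
                 \<and> - \<phi>2 y - q y * \<phi> y = ev * \<phi> y)
      \<and> \<phi> y1 = 0 \<and> \<phi> y2 = 0 \<and> (\<exists>y\<in>{y1..y2}. \<phi> y \<noteq> 0)}"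

definition dir_eigval :: "real \<Rightarrow> real \<Rightarrow> (real \<Rightarrow> real) \<Rightarrow> nat \<Rightarrow> real" where
  "dir_eigval y1 y2 q n = (THE ev. ev \<in> dir_eigs y1 y2 q \<and> card {\<mu> \<in> dir_eigs y1 y2 q. \<mu> < ev} = n - 1)"

definition lam :: "real \<Rightarrow> real \<Rightarrow> (real \<Rightarrow> real) \<Rightarrow> (real \<Rightarrow> real) \<Rightarrow> nat \<Rightarrow> real \<Rightarrow> real \<Rightarrow> real" where
  "lam y1 y2 U U2 n \<beta> c = dir_eigval y1 y2 (\<lambda>y. (\<beta> - U2 y) / (U y - c)) n"

definition dir_inv :: "real \<Rightarrow> real \<Rightarrow> real \<Rightarrow> (real \<Rightarrow> complex) \<Rightarrow> (real \<Rightarrow> complex)" where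
  "dir_inv y1 y2 \<alpha> f = (THE u. (\<exists>u1 u2.
      \<forall>y\<in>{y1..y2}. (u has_vector_derivative u1 y) (at y within {y1..y2})
                 \<and> (u1 has_vector_derivative u2 y) (at y within {y1..y2})
                 \<and> - u2 y + complex_of_real (\<alpha>\<^sup>2) * u y = f y)
      \<and> u y1 = 0 \<and> u y2 = 0 \<and> (\<forall>y. y \<notin> {y1..y2} \<longrightarrow> u y = 0))"

definition ip :: "real \<Rightarrow> real \<Rightarrow> (real \<Rightarrow> complex) \<Rightarrow> (real \<Rightarrow> complex) \<Rightarrow> complex" where
  "ip y1 y2 f g = integral {y1..y2} (\<lambda>y. f y * cnj (g y))"

definition L_op :: "real \<Rightarrow> real \<Rightarrow> (real \<Rightarrow> real) \<Rightarrow> real \<Rightarrow> (real \<Rightarrow> complex) \<Rightarrow> (real \<Rightarrow> complex)" where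
  "L_op y1 y2 K \<alpha> f = (\<lambda>y. f y / complex_of_real (K y) - dir_inv y1 y2 \<alpha> f y)"

end

theory Submission
  imports Defs
begin

text \<open>
  Eigenvalues are located by the Pruefer angle, the solution of
  \<open>\<theta>' = cos\<^sup>2 \<theta> + (q + \<mu>) sin\<^sup>2 \<theta>\<close>, \<open>\<theta>(y\<^sub>1) = 0\<close>: its value at \<open>y\<^sub>2\<close> is strictly increasing
  and continuous in \<open>\<mu>\<close>, depends continuously on \<open>q\<close>, and \<open>\<mu>\<close> is the \<open>n\<close>-th Dirichlet eigenvalue iff
  it equals \<open>n\<pi>\<close>. By the intermediate value theorem the \<open>n\<close>-th eigenvalue therefore persists and moves
  continuously when \<open>c\<close> is perturbed, and the Wronskian identity
  \<open>(\<lambda>(c') - \<lambda>(c)) \<integral> u w = - \<integral> (q\<^sub>c\<^sub>' - q\<^sub>c) u w\<close> for the eigenfunctions \<open>u\<close>, \<open>w\<close> at \<open>c\<close>, \<open>c'\<close> yields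
  \<open>\<partial>\<lambda>/\<partial>c = - \<integral> (\<beta> - U'') / (U - c)\<^sup>2 |\<phi>|\<^sup>2\<close>.
  Since \<open>\<omega> = K\<^sub>\<beta> (U - U\<^sub>\<beta>) / (U - c) \<phi>\<close>, the quadratic form of \<open>L\<^sub>\<alpha>\<close> at \<open>\<omega>\<close> is the same integral times \<open>c - U\<^sub>\<beta>\<close>.
\<close>

section \<open>Differential inequalities and Picard iteration\<close>

lemma nondecreasing_within_Icc:
  fixes f f' :: "real \<Rightarrow> real"
  assumes "\<And>y. y \<in> {a..b} \<Longrightarrow> (f has_real_derivative f' y) (at y within {a..b})"
    and "\<And>y. y \<in> {a..b} \<Longrightarrow> 0 \<le> f' y"
    and "a \<le> x" "x \<le> z" "z \<le> b"
  shows "f x \<le> f z"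
proof (rule DERIV_nonneg_imp_increasing_open[OF \<open>x \<le> z\<close>])
  fix y assume "x < y" "y < z"
  with assms(3-5) have "y \<in> {a..b}" "a < y" "y < b" by auto
  with assms(1)[of y] assms(2)[of y] show "\<exists>d. DERIV f y :> d \<and> 0 \<le> d"
    by (auto simp: at_within_Icc_at)
next
  have "continuous_on {a..b} f"
    by (rule DERIV_continuous_on[OF assms(1)])
  then show "continuous_on {x..z} f"
    by (rule continuous_on_subset) (use assms(3-5) in auto)
qed

lemma continuous_on_Icc_bound:
  fixes f :: "real \<Rightarrow> real"
  assumes "continuous_on {a..b} f"
  obtains M where "0 \<le> M" "\<And>y. y \<in> {a..b} \<Longrightarrow> \<bar>f y\<bar> \<le> M"
proof -
  have "bounded (f ` {a..b})"
    by (intro compact_imp_bounded compact_continuous_image assms compact_Icc)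
  then obtain M where "\<forall>y\<in>{a..b}. \<bar>f y\<bar> \<le> M" by (auto simp: bounded_iff)
  then show thesis by (intro that[of "max 0 M"]) (auto simp: le_max_iff_disj)
qed

text \<open>The derivative is taken within the interval, so both endpoints are included. This closes
  the contradictions below in which a function vanishing on the whole interval has slope 1 at
  \<open>a\<close>.\<close>

lemma derivative_zero_within_Icc:
  fixes w :: "real \<Rightarrow> real"
  assumes "a < b" and zero: "\<And>y. y \<in> {a..b} \<Longrightarrow> w y = 0" and y: "y \<in> {a..b}"
    and der: "(w has_real_derivative d) (at y within {a..b})"
  shows "d = 0"
proof (rule vector_derivative_unique_within_closed_interval[of a b y w])
  show "(w has_vector_derivative d) (at y within cbox a b)"
    using der by (simp add: has_real_derivative_iff_has_vector_derivative)
  have "(w has_real_derivative 0) (at y within {a..b})"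
    by (rule has_field_derivative_transform_within[OF DERIV_const zero_less_one y]) (simp add: zero)
  then show "(w has_vector_derivative 0) (at y within cbox a b)"
    by (simp add: has_real_derivative_iff_has_vector_derivative)
qed (use assms in auto)

text \<open>The function \<open>B * (y - a) - exp (- A * (y - a)) * E y\<close> starts at 0 and has
  derivative at least \<open>B * (1 - exp (- A * (y - a)))\<close>, which is nonnegative. Bounding
  the exponential by 1 avoids a division by \<open>A\<close>, so \<open>A = 0\<close> is
  covered.\<close>

lemma gronwall_differential:
  fixes E E' :: "real \<Rightarrow> real"
  assumes der: "\<And>y. y \<in> {a..b} \<Longrightarrow> (E has_real_derivative E' y) (at y within {a..b})"
    and le: "\<And>y. y \<in> {a..b} \<Longrightarrow> E' y \<le> A * E y + B"
    and "E a = 0" "0 \<le> A" "0 \<le> B" and y: "y \<in> {a..b}"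
  shows "E y \<le> B * (y - a) * exp (A * (y - a))"
proof -
  define F where "F = (\<lambda>y. B * (y - a) - exp (- A * (y - a)) * E y)"
  have "F a \<le> F y"
  proof (rule nondecreasing_within_Icc[where f = F and a = a and b = b])
    fix y assume y: "y \<in> {a..b}"
    show "(F has_real_derivative (B - exp (- A * (y - a)) * (E' y - A * E y))) (at y within {a..b})"
      unfolding F_def by (auto intro!: derivative_eq_intros der y simp: algebra_simps)
    have "exp (- A * (y - a)) * (E' y - A * E y) \<le> exp (- A * (y - a)) * B"
      using le[OF y] by (intro mult_left_mono) auto
    also have "\<dots> \<le> 1 * B"
      using y \<open>0 \<le> A\<close> \<open>0 \<le> B\<close> by (intro mult_right_mono) auto
    finally show "0 \<le> B - exp (- A * (y - a)) * (E' y - A * E y)" by simp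
  qed (use y in auto)
  then have "exp (- A * (y - a)) * E y \<le> B * (y - a)"
    using \<open>E a = 0\<close> by (simp add: F_def)
  then have "exp (A * (y - a)) * (exp (- A * (y - a)) * E y) \<le> exp (A * (y - a)) * (B * (y - a))"
    by (rule mult_left_mono) simp
  then show ?thesis
    by (simp add: mult.assoc[symmetric] exp_add[symmetric]) (simp add: mult_ac)
qed

text \<open>Suppose \<open>w x < 0\<close> and let \<open>s\<close> be the last point before
  \<open>x\<close> with \<open>w s \<ge> 0\<close>. Past \<open>s\<close> the function is negative,
  so the bound reads \<open>w' \<ge> L * w\<close>, and \<open>exp (- L * y) * w y\<close> is
  nondecreasing from \<open>s\<close> to \<open>x\<close>; this carries the sign of
  \<open>w s\<close> to \<open>x\<close>.\<close>

lemma nonneg_of_derivative_ge: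
  fixes w w' :: "real \<Rightarrow> real"
  assumes der: "\<And>y. y \<in> {a..b} \<Longrightarrow> (w has_real_derivative w' y) (at y within {a..b})"
    and ge: "\<And>y. y \<in> {a..b} \<Longrightarrow> - L * \<bar>w y\<bar> \<le> w' y"
    and "0 \<le> w a" and x: "x \<in> {a..b}"
  shows "0 \<le> w x"
proof (rule ccontr)
  assume neg: "\<not> 0 \<le> w x"
  have cont: "continuous_on {a..b} w"
    by (rule DERIV_continuous_on[OF der])
  define S where "S = {a..x} \<inter> w -` {0..}"
  have "closed S" unfolding S_def
    by (rule continuous_closed_preimage)
      (use x in \<open>auto intro: continuous_on_subset[OF cont]\<close>)
  then have "compact S"
    by (metis S_def closed_Int_compact compact_Icc inf.right_idem inf_commute)
  moreover have "a \<in> S" using \<open>0 \<le> w a\<close> x by (auto simp: S_def)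
  ultimately obtain s where s: "s \<in> S" "\<And>t. t \<in> S \<Longrightarrow> t \<le> s"
    using compact_attains_sup[of S] by auto
  have sx: "a \<le> s" "s \<le> x" "0 \<le> w s" using s(1) by (auto simp: S_def)
  have after: "w t < 0" if "s < t" "t \<le> x" for t
    using s(2)[of t] that sx by (auto simp: S_def not_le[symmetric])
  have "exp (- L * s) * w s \<le> exp (- L * x) * w x"
  proof (rule DERIV_nonneg_imp_increasing_open[where f = "\<lambda>y. exp (- L * y) * w y", OF \<open>s \<le> x\<close>])
    fix t assume t: "s < t" "t < x"
    then have tab: "t \<in> {a..b}" "a < t" "t < b" using sx x by auto
    have "DERIV (\<lambda>y. exp (- L * y) * w y) t :> exp (- L * t) * (w' t - L * w t)"
      using der[OF tab(1)] tab by (auto intro!: derivative_eq_intros simp: at_within_Icc_at algebra_simps)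
    moreover have "0 \<le> w' t - L * w t"
      using ge[OF tab(1)] after[of t] t by simp
    ultimately show "\<exists>d. DERIV (\<lambda>y. exp (- L * y) * w y) t :> d \<and> 0 \<le> d"
      by (metis exp_ge_zero mult_nonneg_nonneg)
  next
    show "continuous_on {s..x} (\<lambda>y. exp (- L * y) * w y)"
      by (intro continuous_intros continuous_on_subset[OF cont]) (use sx x in auto)
  qed
  moreover have "0 \<le> exp (- L * s) * w s" using sx by simp
  moreover have "exp (- L * x) * w x < 0" using neg by (simp add: mult_pos_neg)
  ultimately show False by linarith
qed

text \<open>By the previous comparison \<open>w\<close> is nonnegative, hence
  \<open>exp (L * y) * w y\<close> is nondecreasing, and its value at \<open>b\<close> is at most 0.
  This is the source of strict inequalities: if a strict comparison fails at \<open>b\<close>, the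
  two compared functions agree everywhere.\<close>

lemma zero_of_derivative_ge:
  fixes w w' :: "real \<Rightarrow> real"
  assumes der: "\<And>y. y \<in> {a..b} \<Longrightarrow> (w has_real_derivative w' y) (at y within {a..b})"
    and ge: "\<And>y. y \<in> {a..b} \<Longrightarrow> - L * \<bar>w y\<bar> \<le> w' y"
    and "0 \<le> w a" "w b \<le> 0" and x: "x \<in> {a..b}"
  shows "w x = 0"
proof -
  have nn: "0 \<le> w y" if "y \<in> {a..b}" for y
    by (rule nonneg_of_derivative_ge[OF der ge]) (use assms that in auto)
  have "exp (L * x) * w x \<le> exp (L * b) * w b"
  proof (rule nondecreasing_within_Icc[where f = "\<lambda>y. exp (L * y) * w y" and a = a and b = b])
    fix y assume y: "y \<in> {a..b}"
    show "((\<lambda>y. exp (L * y) * w y) has_real_derivative exp (L * y) * (w' y + L * w y)) (at y within {a..b})"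
      by (auto intro!: derivative_eq_intros der y simp: algebra_simps)
    show "0 \<le> exp (L * y) * (w' y + L * w y)"
      using ge[OF y] nn[OF y] by simp
  qed (use x in auto)
  also have "\<dots> \<le> 0" using \<open>w b \<le> 0\<close> by (simp add: mult_nonneg_nonpos)
  finally have "w x \<le> 0" by (simp add: mult_le_0_iff)
  with nn[OF x] show ?thesis by simp
qed

text \<open>Successive approximations converge on the whole interval at once: measured against the
  weight \<open>exp (2 * M * (y - a))\<close>, one application of the integral operator shrinks
  differences by the factor 1/2.\<close>

lemma picard_lindelof_scalar:
  fixes G :: "real \<Rightarrow> real \<Rightarrow> real"
  assumes "a \<le> b" and cont: "continuous_on ({a..b} \<times> UNIV) (\<lambda>(y, x). G y x)"
    and lip: "\<And>y x x'. y \<in> {a..b} \<Longrightarrow> \<bar>G y x - G y x'\<bar> \<le> L * \<bar>x - x'\<bar>"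
  shows "\<exists>\<theta>. \<theta> a = x0 \<and> (\<forall>y\<in>{a..b}. (\<theta> has_real_derivative G y (\<theta> y)) (at y within {a..b}))"
proof -
  \<comment> \<open>A strictly positive Lipschitz constant, so that division by \<open>M\<close> is
    possible whatever the sign of \<open>L\<close>.\<close>
  define M where "M = \<bar>L\<bar> + 1"
  have "M > 0" by (simp add: M_def)
  have lipM: "\<bar>G y x - G y x'\<bar> \<le> M * \<bar>x - x'\<bar>" if "y \<in> {a..b}" for y x x'
  proof -
    have "L * \<bar>x - x'\<bar> \<le> M * \<bar>x - x'\<bar>" by (intro mult_right_mono) (auto simp: M_def)
    with lip[OF that, of x x'] show ?thesis by simp
  qed
  have Gc: "continuous_on {a..y} (\<lambda>s. G s (f s))"
    if "continuous_on {a..b} f" "y \<le> b" for f y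
  proof -
    have "continuous_on {a..y} (\<lambda>s. (s, f s))"
      by (intro continuous_intros continuous_on_subset[OF that(1)]) (use that in auto)
    then show ?thesis
      using continuous_on_compose2[OF cont, of "{a..y}" "\<lambda>s. (s, f s)"] that(2) by force
  qed
  define T where "T = (\<lambda>f y. x0 + integral {a..y} (\<lambda>s. G s (f s)))"
  have Tder: "(T f has_real_derivative G y (f y)) (at y within {a..b})"
    if "continuous_on {a..b} f" "y \<in> {a..b}" for f y
    unfolding T_def using integral_has_real_derivative[OF Gc[OF that(1) order_refl] that(2)]
    by (auto intro!: derivative_eq_intros)
  define t where "t = (\<lambda>n. (T ^^ n) (\<lambda>_. x0))"
  have tS: "t (Suc n) = T (t n)" for n by (simp add: t_def)
  then have tSy: "t (Suc n) y = x0 + integral {a..y} (\<lambda>s. G s (t n s))" for n y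
    by (simp add: T_def)
  have tc: "continuous_on {a..b} (t n)" for n
  proof (induction n)
    case 0 then show ?case by (simp add: t_def)
  next
    case (Suc n)
    show ?case unfolding tS by (rule DERIV_continuous_on[OF Tder[OF Suc]])
  qed
  obtain C0 where "0 \<le> C0" and C0: "\<And>s. s \<in> {a..b} \<Longrightarrow> \<bar>G s x0\<bar> \<le> C0"
    by (rule continuous_on_Icc_bound[OF Gc[of "\<lambda>_. x0" b]]) auto
  define C where "C = C0 * (b - a)"
  have "0 \<le> C" using \<open>0 \<le> C0\<close> \<open>a \<le> b\<close> by (simp add: C_def)
  \<comment> \<open>The integral of \<open>M * exp (2 * M * (s - a))\<close> up to \<open>y\<close>
    is less than half of \<open>exp (2 * M * (y - a))\<close>; this produces the powers of
    1/2.\<close>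
  have step: "\<bar>t (Suc n) y - t n y\<bar> \<le> C * (1/2) ^ n * exp (2 * M * (y - a))"
    if "y \<in> {a..b}" for n y
    using that
  proof (induction n arbitrary: y)
    case 0
    have "norm (integral {a..y} (\<lambda>s. G s x0)) \<le> C0 * (y - a)"
      by (rule integral_bound) (use 0 Gc[of "\<lambda>_. x0" y] C0 in auto)
    also have "\<dots> \<le> C * 1" using 0 \<open>0 \<le> C0\<close> by (auto simp: C_def intro: mult_left_mono)
    also have "\<dots> \<le> C * exp (2 * M * (y - a))"
      using 0 \<open>0 \<le> C\<close> \<open>M > 0\<close> by (intro mult_left_mono) auto
    finally show ?case by (simp add: t_def T_def)
  next
    case (Suc n)
    let ?e = "\<lambda>s. C * (1/2) ^ n * M * exp (2 * M * (s - a))"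
    have i: "(\<lambda>s. G s (t n s)) integrable_on {a..y}" for n
      using Gc[OF tc] Suc.prems by (intro integrable_continuous_interval) auto
    have E: "(?e has_integral (C * (1/2) ^ n * exp (2 * M * (y - a)) / 2
        - C * (1/2) ^ n * exp (2 * M * (a - a)) / 2)) {a..y}"
      by (rule fundamental_theorem_of_calculus)
        (use Suc.prems in \<open>auto intro!: derivative_eq_intros
          simp: has_real_derivative_iff_has_vector_derivative[symmetric]\<close>)
    have "t (Suc (Suc n)) y - t (Suc n) y = integral {a..y} (\<lambda>s. G s (t (Suc n) s) - G s (t n s))"
      using integral_diff[OF i[of "Suc n"] i[of n]] tSy[of "Suc n" y] tSy[of n y] by linarith
    also have "\<bar>\<dots>\<bar> \<le> integral {a..y} ?e"
      unfolding real_norm_def[symmetric]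
    proof (rule integral_norm_bound_integral)
      fix s assume s: "s \<in> {a..y}"
      then have s': "s \<in> {a..b}" using Suc.prems by auto
      have "\<bar>G s (t (Suc n) s) - G s (t n s)\<bar> \<le> M * (C * (1/2) ^ n * exp (2 * M * (s - a)))"
        using lipM[OF s', of "t (Suc n) s" "t n s"] mult_left_mono[OF Suc.IH[OF s'], of M] \<open>M > 0\<close>
        by linarith
      then show "norm (G s (t (Suc n) s) - G s (t n s)) \<le> ?e s" by (simp add: mult_ac)
    qed (use i E in \<open>auto intro: integrable_diff\<close>)
    also have "\<dots> \<le> C * (1/2) ^ Suc n * exp (2 * M * (y - a))"
      unfolding integral_unique[OF E] using \<open>0 \<le> C\<close> by simp
    finally show ?case .
  qed
  define Mn where "Mn = (\<lambda>n. C * exp (2 * M * (b - a)) * (1/2::real) ^ n)"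
  have "summable Mn" unfolding Mn_def by (intro summable_mult summable_geometric) simp
  have bound: "norm (t (Suc n) y - t n y) \<le> Mn n" if "y \<in> {a..b}" for n y
  proof -
    have "C * (1/2) ^ n * exp (2 * M * (y - a)) \<le> C * (1/2) ^ n * exp (2 * M * (b - a))"
      using that \<open>0 \<le> C\<close> \<open>M > 0\<close> by (intro mult_left_mono) auto
    with step[OF that, of n] show ?thesis by (simp add: Mn_def mult_ac)
  qed
  have "(\<Sum>i<n. t (Suc i) y - t i y) = t n y - t 0 y" for n y
    by (rule sum_lessThan_telescope)
  with Weierstrass_m_test[of "{a..b}" "\<lambda>n y. t (Suc n) y - t n y", OF bound \<open>summable Mn\<close>]
  have "uniform_limit {a..b} (\<lambda>n y. t n y - t 0 y) (\<lambda>y. \<Sum>i. t (Suc i) y - t i y) sequentially"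
    by simp
  from uniform_limit_add[OF this uniform_limit_const[of "\<lambda>y. t 0 y"]]
  have "uniform_limit {a..b} t (\<lambda>y. (\<Sum>i. t (Suc i) y - t i y) + t 0 y) sequentially" by simp
  then obtain \<theta> where \<theta>: "uniform_limit {a..b} t \<theta> sequentially" by blast
  have \<theta>c: "continuous_on {a..b} \<theta>"
    by (rule uniform_limit_theorem[OF _ \<theta>]) (use tc in auto)
  \<comment> \<open>The Lipschitz bound transfers uniform convergence to the integrands, so the
    limit passes under the integral and \<open>\<theta>\<close> is a fixed point of
    \<open>T\<close>.\<close>
  have G\<theta>: "uniform_limit {a..b} (\<lambda>n s. G s (t n s)) (\<lambda>s. G s (\<theta> s)) sequentially"
  proof (rule uniform_limitI)
    fix e :: real assume "e > 0"
    with \<open>M > 0\<close> have "\<forall>\<^sub>F n in sequentially. \<forall>s\<in>{a..b}. dist (t n s) (\<theta> s) < e / M"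
      by (intro uniform_limitD[OF \<theta>]) simp
    then show "\<forall>\<^sub>F n in sequentially. \<forall>s\<in>{a..b}. dist (G s (t n s)) (G s (\<theta> s)) < e"
    proof eventually_elim
      case (elim n)
      show ?case
      proof
        fix s assume s: "s \<in> {a..b}"
        have "M * dist (t n s) (\<theta> s) < e"
          using bspec[OF elim s] \<open>M > 0\<close> by (simp add: pos_less_divide_eq mult.commute)
        with lipM[OF s, of "t n s" "\<theta> s"] show "dist (G s (t n s)) (G s (\<theta> s)) < e"
          by (simp add: dist_real_def)
      qed
    qed
  qed
  have fix_eq: "\<theta> y = T \<theta> y" if y: "y \<in> {a..b}" for y
  proof (rule LIMSEQ_unique)
    show "(\<lambda>n. t (Suc n) y) \<longlonglongrightarrow> \<theta> y"
      using tendsto_uniform_limitI[OF \<theta> y] by (rule LIMSEQ_Suc)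
    have "uniform_limit {a..y} (\<lambda>n s. G s (t n s)) (\<lambda>s. G s (\<theta> s)) sequentially"
      by (rule uniform_limit_on_subset[OF G\<theta>]) (use y in auto)
    then obtain I J where "\<And>n. ((\<lambda>s. G s (t n s)) has_integral I n) {a..y}"
      "((\<lambda>s. G s (\<theta> s)) has_integral J) {a..y}" "I \<longlonglongrightarrow> J"
      by (rule uniform_limit_integral) (use Gc[OF tc] y in auto)
    then have "I = (\<lambda>n. integral {a..y} (\<lambda>s. G s (t n s)))" "J = integral {a..y} (\<lambda>s. G s (\<theta> s))"
      by (metis integral_unique)+
    with \<open>I \<longlonglongrightarrow> J\<close> show "(\<lambda>n. t (Suc n) y) \<longlonglongrightarrow> T \<theta> y"
      unfolding tS T_def by (auto intro!: tendsto_intros)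
  qed
  show ?thesis
  proof (intro exI[of _ \<theta>] conjI ballI)
    show "\<theta> a = x0" using fix_eq[of a] \<open>a \<le> b\<close> by (simp add: T_def)
    fix y assume y: "y \<in> {a..b}"
    show "(\<theta> has_real_derivative G y (\<theta> y)) (at y within {a..b})"
      by (rule has_field_derivative_transform_within[OF Tder[OF \<theta>c y] zero_less_one y])
        (simp add: fix_eq)
  qed
qed

section \<open>The Pruefer angle\<close>

lemma sin_squared_diff: "(sin x)\<^sup>2 - (sin y)\<^sup>2 = sin (x + y) * sin (x - y)" for x y :: real
proof -
  have "sin (x + y) * sin (x - y)
      = (sin x)\<^sup>2 * (cos y)\<^sup>2 - (cos x)\<^sup>2 * (sin y)\<^sup>2"
    by (simp add: sin_add sin_diff power2_eq_square algebra_simps)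
  also have "\<dots> = (sin x)\<^sup>2 - (sin y)\<^sup>2"
    unfolding cos_squared_eq by (simp add: algebra_simps)
  finally show ?thesis by simp
qed

lemma abs_sin_squared_diff_le: "\<bar>(sin x)\<^sup>2 - (sin y)\<^sup>2\<bar> \<le> \<bar>x - y\<bar>" for x y :: real
proof -
  have "\<bar>sin (x + y)\<bar> * \<bar>sin (x - y)\<bar> \<le> 1 * \<bar>x - y\<bar>"
    by (intro mult_mono abs_sin_x_le_abs_x) auto
  then show ?thesis by (simp add: sin_squared_diff abs_mult)
qed

text \<open>For \<open>u'' = - p u\<close> with \<open>u a = 0\<close>, the substitution
  \<open>u = r sin \<theta>\<close>, \<open>u' = r cos \<theta>\<close> gives
  \<open>\<theta>' = cos^2 \<theta> + p sin^2 \<theta>\<close>. Writing this as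
  \<open>1 + (p - 1) sin^2 \<theta>\<close> leaves a single nonlinear term, Lipschitz in the angle
  with constant \<open>|p - 1|\<close>.\<close>

definition pruefer :: "real \<Rightarrow> real \<Rightarrow> (real \<Rightarrow> real) \<Rightarrow> (real \<Rightarrow> real) \<Rightarrow> bool" where
  "pruefer a b p \<theta> \<longleftrightarrow> \<theta> a = 0 \<and>
     (\<forall>y\<in>{a..b}. (\<theta> has_real_derivative 1 + (p y - 1) * (sin (\<theta> y))\<^sup>2) (at y within {a..b}))"

lemma prueferD:
  assumes "pruefer a b p \<theta>"
  shows "\<theta> a = 0"
    and "y \<in> {a..b} \<Longrightarrow> (\<theta> has_real_derivative 1 + (p y - 1) * (sin (\<theta> y))\<^sup>2) (at y within {a..b})"
    and "continuous_on {a..b} \<theta>"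
  using assms unfolding pruefer_def by (auto intro!: DERIV_continuous_on)

lemma pruefer_exists:
  assumes "a \<le> b" "continuous_on {a..b} p"
  shows "\<exists>\<theta>. pruefer a b p \<theta>"
proof -
  obtain M where M: "0 \<le> M" "\<And>y. y \<in> {a..b} \<Longrightarrow> \<bar>p y - 1\<bar> \<le> M"
    by (rule continuous_on_Icc_bound[of a b "\<lambda>y. p y - 1"]) (auto intro: continuous_intros assms)
  show ?thesis unfolding pruefer_def
  proof (rule picard_lindelof_scalar[OF \<open>a \<le> b\<close>, where L = M and G = "\<lambda>y x. 1 + (p y - 1) * (sin x)\<^sup>2"])
    have "continuous_on ({a..b} \<times> UNIV) (\<lambda>z::real\<times>real. p (fst z))"
      by (rule continuous_on_compose2[OF assms(2)]) (auto intro: continuous_intros)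
    then show "continuous_on ({a..b} \<times> UNIV) (\<lambda>(y, x). 1 + (p y - 1) * (sin x)\<^sup>2)"
      unfolding case_prod_beta by (intro continuous_intros)
    fix y x x' :: real assume "y \<in> {a..b}"
    then have "\<bar>p y - 1\<bar> * \<bar>(sin x)\<^sup>2 - (sin x')\<^sup>2\<bar> \<le> M * \<bar>x - x'\<bar>"
      using M by (intro mult_mono abs_sin_squared_diff_le) auto
    then show "\<bar>1 + (p y - 1) * (sin x)\<^sup>2 - (1 + (p y - 1) * (sin x')\<^sup>2)\<bar> \<le> M * \<bar>x - x'\<bar>"
      by (simp add: abs_mult[symmetric] algebra_simps)
  qed
qed

text \<open>Since \<open>sin^2 \<theta> \<le> |\<theta>|\<close>, the equation gives
  \<open>\<theta>' \<ge> - M |\<theta>|\<close>. An endpoint value at most 0 would force the angle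
  to vanish identically, against its slope 1 at \<open>a\<close>.\<close>

lemma pruefer_pos:
  assumes "a < b" "continuous_on {a..b} p" and pr: "pruefer a b p \<theta>"
  shows "0 < \<theta> b"
proof (rule ccontr)
  assume "\<not> 0 < \<theta> b"
  obtain M where M: "0 \<le> M" "\<And>y. y \<in> {a..b} \<Longrightarrow> \<bar>p y - 1\<bar> \<le> M"
    by (rule continuous_on_Icc_bound[of a b "\<lambda>y. p y - 1"]) (auto intro: continuous_intros assms)
  have zero: "\<theta> y = 0" if "y \<in> {a..b}" for y
  proof (rule zero_of_derivative_ge[OF prueferD(2)[OF pr]])
    fix y assume "y \<in> {a..b}"
    then have "\<bar>p y - 1\<bar> * \<bar>(sin (\<theta> y))\<^sup>2 - (sin 0)\<^sup>2\<bar> \<le> M * \<bar>\<theta> y - 0\<bar>"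
      using M by (intro mult_mono abs_sin_squared_diff_le) auto
    then have "\<bar>(p y - 1) * (sin (\<theta> y))\<^sup>2\<bar> \<le> M * \<bar>\<theta> y\<bar>" by (simp add: abs_mult)
    then show "- M * \<bar>\<theta> y\<bar> \<le> 1 + (p y - 1) * (sin (\<theta> y))\<^sup>2"
      by linarith
  qed (use \<open>\<not> 0 < \<theta> b\<close> prueferD(1)[OF pr] that in auto)
  have "1 + (p a - 1) * (sin (\<theta> a))\<^sup>2 = 0"
    by (rule derivative_zero_within_Icc[OF \<open>a < b\<close> zero _ prueferD(2)[OF pr]]) (use \<open>a < b\<close> in auto)
  then show False by (simp add: prueferD(1)[OF pr])
qed

text \<open>For \<open>p \<le> 0\<close> the slope is at most \<open>1 - sin^2 \<theta>\<close>,
  which is bounded by the distance of \<open>\<theta>\<close> to \<open>pi / 2\<close>; so the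
  constant \<open>pi / 2\<close> is a barrier. The bound excludes eigenvalues for nonpositive
  potentials and starts the intermediate value argument below the level \<open>pi\<close>.\<close>

lemma pruefer_le_half_pi:
  assumes "a \<le> b" and pr: "pruefer a b p \<theta>" and neg: "\<And>y. y \<in> {a..b} \<Longrightarrow> p y \<le> 0"
  shows "\<theta> b \<le> pi / 2"
proof -
  have "0 \<le> pi / 2 - \<theta> b"
  proof (rule nonneg_of_derivative_ge[where L = 1 and a = a and b = b and w = "\<lambda>y. pi / 2 - \<theta> y"])
    fix y assume y: "y \<in> {a..b}"
    show "((\<lambda>y. pi / 2 - \<theta> y) has_real_derivative - (1 + (p y - 1) * (sin (\<theta> y))\<^sup>2)) (at y within {a..b})"
      by (auto intro!: derivative_eq_intros prueferD(2)[OF pr y])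
    have "p y * (sin (\<theta> y))\<^sup>2 \<le> 0" using neg[OF y] by (simp add: mult_nonpos_nonneg)
    moreover have "(sin (pi / 2))\<^sup>2 - (sin (\<theta> y))\<^sup>2 \<le> \<bar>pi / 2 - \<theta> y\<bar>"
      using abs_sin_squared_diff_le[of "pi / 2" "\<theta> y"] by linarith
    ultimately show "- 1 * \<bar>pi / 2 - \<theta> y\<bar> \<le> - (1 + (p y - 1) * (sin (\<theta> y))\<^sup>2)"
      by (simp add: algebra_simps)
  qed (use assms prueferD(1)[OF pr] in auto)
  then show ?thesis by simp
qed

text \<open>The difference \<open>w\<close> of the angles satisfies \<open>w' \<ge> - M |w|\<close>.
  If it were not positive at \<open>b\<close>, it would vanish identically; then
  \<open>(p' - p) sin^2 \<theta> = 0\<close> makes \<open>sin \<theta>\<close> vanish identically,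
  although its slope at \<open>a\<close> is 1.\<close>

lemma pruefer_strict_mono:
  assumes "a < b" "continuous_on {a..b} p'" and pr: "pruefer a b p \<theta>" and pr': "pruefer a b p' \<theta>'"
    and less: "\<And>y. y \<in> {a..b} \<Longrightarrow> p y < p' y"
  shows "\<theta> b < \<theta>' b"
proof (rule ccontr)
  assume "\<not> \<theta> b < \<theta>' b"
  obtain M where M: "0 \<le> M" "\<And>y. y \<in> {a..b} \<Longrightarrow> \<bar>p' y - 1\<bar> \<le> M"
    by (rule continuous_on_Icc_bound[of a b "\<lambda>y. p' y - 1"]) (auto intro: continuous_intros assms)
  define w where "w = (\<lambda>y. \<theta>' y - \<theta> y)"
  define w' where "w' = (\<lambda>y. (p' y - 1) * ((sin (\<theta>' y))\<^sup>2 - (sin (\<theta> y))\<^sup>2) + (p' y - p y) * (sin (\<theta> y))\<^sup>2)"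
  have der: "(w has_real_derivative w' y) (at y within {a..b})" if "y \<in> {a..b}" for y
    unfolding w_def w'_def
    by (rule derivative_eq_intros prueferD(2)[OF pr that] prueferD(2)[OF pr' that])+ (simp add: algebra_simps)
  have zero: "w y = 0" if "y \<in> {a..b}" for y
  proof (rule zero_of_derivative_ge[OF der])
    fix y assume y: "y \<in> {a..b}"
    then have "\<bar>p' y - 1\<bar> * \<bar>(sin (\<theta>' y))\<^sup>2 - (sin (\<theta> y))\<^sup>2\<bar> \<le> M * \<bar>w y\<bar>"
      unfolding w_def using M by (intro mult_mono abs_sin_squared_diff_le) auto
    then have "\<bar>(p' y - 1) * ((sin (\<theta>' y))\<^sup>2 - (sin (\<theta> y))\<^sup>2)\<bar> \<le> M * \<bar>w y\<bar>" by (simp add: abs_mult)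
    moreover have "0 \<le> (p' y - p y) * (sin (\<theta> y))\<^sup>2" using less[OF y] by simp
    ultimately show "- M * \<bar>w y\<bar> \<le> w' y" unfolding w'_def by linarith
  qed (use \<open>\<not> \<theta> b < \<theta>' b\<close> prueferD(1)[OF pr] prueferD(1)[OF pr'] that in \<open>auto simp: w_def\<close>)
  have sin0: "sin (\<theta> y) = 0" if y: "y \<in> {a..b}" for y
  proof -
    have "w' y = 0"
      by (rule derivative_zero_within_Icc[OF \<open>a < b\<close> zero y der[OF y]])
    moreover have "\<theta>' y = \<theta> y" using zero[OF y] by (simp add: w_def)
    ultimately show ?thesis using less[OF y] by (simp add: w'_def)
  qed
  have a: "a \<in> {a..b}" using \<open>a < b\<close> by simp
  have "((\<lambda>y. sin (\<theta> y)) has_real_derivative 1) (at a within {a..b})"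
    by (rule derivative_eq_intros prueferD(2)[OF pr a])+ (simp add: prueferD(1)[OF pr])
  from derivative_zero_within_Icc[OF \<open>a < b\<close> sin0 a this] show False by simp
qed

text \<open>Gronwall's inequality is applied to the squared difference, which stays differentiable
  where the difference changes sign. The mixed term is split by
  \<open>2 w d \<le> w^2 + d^2\<close>, whence the rate \<open>2 * M + 1\<close> and the source
  \<open>d^2\<close>.\<close>

lemma pruefer_lipschitz:
  assumes "a \<le> b" and pr: "pruefer a b p \<theta>" and pr': "pruefer a b p' \<theta>'"
    and M: "\<And>y. y \<in> {a..b} \<Longrightarrow> \<bar>p y - 1\<bar> \<le> M"
    and d: "\<And>y. y \<in> {a..b} \<Longrightarrow> \<bar>p' y - p y\<bar> \<le> d"
  shows "(\<theta>' b - \<theta> b)\<^sup>2 \<le> d\<^sup>2 * (b - a) * exp ((2 * M + 1) * (b - a))"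
proof (rule gronwall_differential[where E = "\<lambda>y. (\<theta>' y - \<theta> y)\<^sup>2"])
  define E' where "E' = (\<lambda>y. 2 * (\<theta>' y - \<theta> y) *
    ((p y - 1) * ((sin (\<theta>' y))\<^sup>2 - (sin (\<theta> y))\<^sup>2) + (p' y - p y) * (sin (\<theta>' y))\<^sup>2))"
  fix y assume y: "y \<in> {a..b}"
  show "((\<lambda>y. (\<theta>' y - \<theta> y)\<^sup>2) has_real_derivative E' y) (at y within {a..b})"
    unfolding E'_def
    by (auto intro!: derivative_eq_intros prueferD(2)[OF pr y] prueferD(2)[OF pr' y] simp: algebra_simps)
  let ?w = "\<bar>\<theta>' y - \<theta> y\<bar>"
  have "\<bar>p y - 1\<bar> * \<bar>(sin (\<theta>' y))\<^sup>2 - (sin (\<theta> y))\<^sup>2\<bar> \<le> M * ?w"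
    using M[OF y] by (intro mult_mono abs_sin_squared_diff_le) auto
  moreover have "\<bar>p' y - p y\<bar> * \<bar>(sin (\<theta>' y))\<^sup>2\<bar> \<le> d * 1"
    using d[OF y] by (intro mult_mono) (auto simp: abs_square_le_1)
  ultimately have "\<bar>(p y - 1) * ((sin (\<theta>' y))\<^sup>2 - (sin (\<theta> y))\<^sup>2) + (p' y - p y) * (sin (\<theta>' y))\<^sup>2\<bar> \<le> M * ?w + d"
    by (intro order_trans[OF abs_triangle_ineq]) (simp add: abs_mult)
  then have "2 * ?w * \<bar>(p y - 1) * ((sin (\<theta>' y))\<^sup>2 - (sin (\<theta> y))\<^sup>2) + (p' y - p y) * (sin (\<theta>' y))\<^sup>2\<bar>
      \<le> 2 * ?w * (M * ?w + d)"
    by (intro mult_left_mono) auto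
  moreover have "E' y \<le> \<bar>E' y\<bar>" by simp
  ultimately have "E' y \<le> 2 * ?w * (M * ?w + d)"
    unfolding E'_def abs_mult abs_numeral by linarith
  also have "\<dots> = 2 * M * ?w\<^sup>2 + 2 * ?w * d" by (simp add: algebra_simps power2_eq_square)
  also have "\<dots> \<le> 2 * M * ?w\<^sup>2 + (?w\<^sup>2 + d\<^sup>2)" using sum_squares_bound[of ?w d] by simp
  finally show "E' y \<le> (2 * M + 1) * (\<theta>' y - \<theta> y)\<^sup>2 + d\<^sup>2" by (simp add: algebra_simps)
next
  have "0 \<le> M" using M[of a] \<open>a \<le> b\<close> by auto
  then show "0 \<le> 2 * M + 1" by simp
qed (use assms prueferD(1)[OF pr] prueferD(1)[OF pr'] in auto)

section \<open>Linear second-order equations\<close>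

text \<open>The spectral parameter is absorbed into the potential: eigenfunctions of
  \<open>q\<close> for \<open>\<mu>\<close> are solutions for \<open>p = q + \<mu>\<close>, with
  \<open>v\<close> in the role of \<open>u'\<close>.\<close>

definition schr_sol :: "real \<Rightarrow> real \<Rightarrow> (real \<Rightarrow> real) \<Rightarrow> (real \<Rightarrow> real) \<Rightarrow> (real \<Rightarrow> real) \<Rightarrow> bool" where
  "schr_sol a b p u v \<longleftrightarrow> (\<forall>y\<in>{a..b}. (u has_real_derivative v y) (at y within {a..b})
     \<and> (v has_real_derivative - p y * u y) (at y within {a..b}))"

lemma schr_solD:
  assumes "schr_sol a b p u v"
  shows "y \<in> {a..b} \<Longrightarrow> (u has_real_derivative v y) (at y within {a..b})"
    and "y \<in> {a..b} \<Longrightarrow> (v has_real_derivative - p y * u y) (at y within {a..b})"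
    and "continuous_on {a..b} u"
  using assms unfolding schr_sol_def by (auto intro!: DERIV_continuous_on)

text \<open>Energy estimate for \<open>e^2 + f^2\<close>: the cross term
  \<open>2 e f (1 - p)\<close> costs the rate \<open>M + 1\<close>, and splitting
  \<open>2 f g\<close> costs a further 1. The case \<open>g = 0\<close> gives uniqueness, a small
  \<open>g\<close> gives continuous dependence on the potential.\<close>

lemma linear_system_bound:
  fixes e f p g :: "real \<Rightarrow> real"
  assumes e: "\<And>y. y \<in> {a..b} \<Longrightarrow> (e has_real_derivative f y) (at y within {a..b})"
    and f: "\<And>y. y \<in> {a..b} \<Longrightarrow> (f has_real_derivative - p y * e y + g y) (at y within {a..b})"
    and M: "\<And>y. y \<in> {a..b} \<Longrightarrow> \<bar>p y\<bar> \<le> M"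
    and d: "\<And>y. y \<in> {a..b} \<Longrightarrow> \<bar>g y\<bar> \<le> d"
    and init: "e a = 0" "f a = 0" and y: "y \<in> {a..b}"
  shows "(e y)\<^sup>2 + (f y)\<^sup>2 \<le> d\<^sup>2 * (y - a) * exp ((M + 2) * (y - a))"
proof (rule gronwall_differential[where E = "\<lambda>y. (e y)\<^sup>2 + (f y)\<^sup>2", OF _ _ _ _ _ y])
  define E' where "E' = (\<lambda>y. 2 * e y * f y * (1 - p y) + 2 * f y * g y)"
  fix y assume y: "y \<in> {a..b}"
  show "((\<lambda>y. (e y)\<^sup>2 + (f y)\<^sup>2) has_real_derivative E' y) (at y within {a..b})"
    unfolding E'_def by (auto intro!: derivative_eq_intros e f y simp: algebra_simps)
  have M': "\<bar>1 - p y\<bar> \<le> M + 1" using M[OF y] by linarith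
  then have "\<bar>2 * e y * f y\<bar> * \<bar>1 - p y\<bar> \<le> ((e y)\<^sup>2 + (f y)\<^sup>2) * (M + 1)"
    using sum_squares_bound[of "\<bar>e y\<bar>" "\<bar>f y\<bar>"] by (intro mult_mono) (auto simp: abs_mult)
  moreover have "2 * \<bar>f y\<bar> * \<bar>g y\<bar> \<le> (f y)\<^sup>2 + d\<^sup>2"
  proof -
    have "2 * \<bar>f y\<bar> * \<bar>g y\<bar> \<le> 2 * \<bar>f y\<bar> * d" using d[OF y] by (intro mult_left_mono) auto
    with sum_squares_bound[of "\<bar>f y\<bar>" d] show ?thesis by simp
  qed
  moreover have "E' y \<le> \<bar>2 * e y * f y\<bar> * \<bar>1 - p y\<bar> + 2 * \<bar>f y\<bar> * \<bar>g y\<bar>"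
  proof -
    have "E' y \<le> \<bar>2 * e y * f y * (1 - p y)\<bar> + \<bar>2 * f y * g y\<bar>" unfolding E'_def by linarith
    then show ?thesis by (simp only: abs_mult abs_numeral)
  qed
  moreover have "0 \<le> (e y)\<^sup>2" by simp
  moreover have "(M + 2) * ((e y)\<^sup>2 + (f y)\<^sup>2) = ((e y)\<^sup>2 + (f y)\<^sup>2) * (M + 1) + (e y)\<^sup>2 + (f y)\<^sup>2"
    by (simp add: algebra_simps)
  ultimately show "E' y \<le> (M + 2) * ((e y)\<^sup>2 + (f y)\<^sup>2) + d\<^sup>2" by linarith
next
  show "0 \<le> M + 2" using M[OF y] by linarith
qed (use init in auto)

text \<open>The difference \<open>\<phi> - \<phi>' a * u\<close> solves the same equation with zero
  initial data, so its energy vanishes; solutions vanishing at \<open>a\<close> form a line.\<close>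

lemma schr_sol_unique:
  assumes "continuous_on {a..b} p" and s: "schr_sol a b p u v" and s': "schr_sol a b p \<phi> \<phi>'"
    and "u a = 0" "v a = 1" "\<phi> a = 0" and y: "y \<in> {a..b}"
  shows "\<phi> y = \<phi>' a * u y" "\<phi>' y = \<phi>' a * v y"
proof -
  obtain M where M: "\<And>y. y \<in> {a..b} \<Longrightarrow> \<bar>p y\<bar> \<le> M"
    using continuous_on_Icc_bound[OF assms(1)] by blast
  have "(\<phi> y - \<phi>' a * u y)\<^sup>2 + (\<phi>' y - \<phi>' a * v y)\<^sup>2 \<le> 0\<^sup>2 * (y - a) * exp ((M + 2) * (y - a))"
    by (rule linear_system_bound[where p = p and b = b and g = "\<lambda>_. 0"])
      (use assms M in \<open>auto intro!: derivative_eq_intros schr_solD(1,2)[OF s] schr_solD(1,2)[OF s'] simp: algebra_simps\<close>)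
  then show "\<phi> y = \<phi>' a * u y" "\<phi>' y = \<phi>' a * v y"
    by (auto simp: sum_power2_le_zero_iff)
qed

text \<open>Recovers the linear solution from the angle. The radius solves
  \<open>r' = (1 - p) sin \<theta> cos \<theta> r\<close> and is an exponential, hence positive, so
  the zeros of the solution are exactly those of \<open>sin \<theta>\<close>.\<close>

lemma pruefer_schr_sol:
  assumes "a \<le> b" "continuous_on {a..b} p" and pr: "pruefer a b p \<theta>"
  obtains r where "r a = 1" "\<And>y. 0 < r y"
    "schr_sol a b p (\<lambda>y. r y * sin (\<theta> y)) (\<lambda>y. r y * cos (\<theta> y))"
proof -
  define h where "h = (\<lambda>y. (1 - p y) * sin (\<theta> y) * cos (\<theta> y))"
  have hc: "continuous_on {a..b} h"
    unfolding h_def by (intro continuous_intros assms prueferD(3)[OF pr])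
  define r where "r = (\<lambda>y. exp (integral {a..y} h))"
  have dr: "(r has_real_derivative r y * h y) (at y within {a..b})" if "y \<in> {a..b}" for y
    unfolding r_def by (auto intro!: derivative_eq_intros integral_has_real_derivative[OF hc that])
  show thesis
  proof (rule that)
    show "r a = 1" "0 < r y" for y by (auto simp: r_def)
    show "schr_sol a b p (\<lambda>y. r y * sin (\<theta> y)) (\<lambda>y. r y * cos (\<theta> y))"
      unfolding schr_sol_def
    proof (intro ballI conjI)
      fix y assume y: "y \<in> {a..b}"
      let ?s = "sin (\<theta> y)" and ?c = "cos (\<theta> y)"
      have c2: "?c * ?c = 1 - ?s * ?s" using cos_squared_eq[of "\<theta> y"] by (simp add: power2_eq_square)
      have 1: "r y * h y * ?s + ?c * (1 + (p y - 1) * ?s\<^sup>2) * r y = r y * ?c"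
        unfolding h_def power2_eq_square by algebra
      show "((\<lambda>y. r y * sin (\<theta> y)) has_real_derivative r y * ?c) (at y within {a..b})"
        by (rule derivative_eq_intros dr[OF y] prueferD(2)[OF pr y] refl)+ (use 1 in simp)
      have "r y * h y * ?c + - ?s * (1 + (p y - 1) * ?s\<^sup>2) * r y
          = r y * ?s * ((1 - p y) * (?c * ?c) - 1 - (p y - 1) * (?s * ?s))"
        unfolding h_def power2_eq_square by algebra
      also have "\<dots> = - p y * (r y * ?s)" unfolding c2 by (simp add: algebra_simps)
      finally have 2: "r y * h y * ?c + - ?s * (1 + (p y - 1) * ?s\<^sup>2) * r y = - p y * (r y * ?s)" .
      show "((\<lambda>y. r y * cos (\<theta> y)) has_real_derivative - p y * (r y * ?s)) (at y within {a..b})"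
        by (rule derivative_eq_intros dr[OF y] prueferD(2)[OF pr y] refl)+ (use 2 in simp)
    qed
  qed
qed

section \<open>Counting Dirichlet eigenvalues\<close>

text \<open>Only the value at the right endpoint matters for locating eigenvalues. The facts above
  hold for every Pruefer angle, so an arbitrary choice suffices.\<close>

definition pruefer_angle :: "real \<Rightarrow> real \<Rightarrow> (real \<Rightarrow> real) \<Rightarrow> real" where
  "pruefer_angle a b p = (SOME \<theta>. pruefer a b p \<theta>) b"

lemma pruefer_angle_cases:
  assumes "a \<le> b" "continuous_on {a..b} p"
  obtains \<theta> where "pruefer a b p \<theta>" "pruefer_angle a b p = \<theta> b"
  by (rule that[OF someI_ex[OF pruefer_exists[OF assms]] pruefer_angle_def])

lemma pruefer_angle_strict_mono:
  assumes "a < b" "continuous_on {a..b} p" "continuous_on {a..b} p'"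
    and "\<And>y. y \<in> {a..b} \<Longrightarrow> p y < p' y"
  shows "pruefer_angle a b p < pruefer_angle a b p'"
proof -
  note le = less_imp_le[OF \<open>a < b\<close>]
  obtain \<theta> where \<theta>: "pruefer a b p \<theta>" "pruefer_angle a b p = \<theta> b"
    by (rule pruefer_angle_cases[OF le assms(2)])
  obtain \<theta>' where \<theta>': "pruefer a b p' \<theta>'" "pruefer_angle a b p' = \<theta>' b"
    by (rule pruefer_angle_cases[OF le assms(3)])
  show ?thesis
    unfolding \<theta>(2) \<theta>'(2) by (rule pruefer_strict_mono[OF assms(1,3) \<theta>(1) \<theta>'(1) assms(4)])
qed

lemma pruefer_angle_tendsto:
  assumes "a \<le> b" and c: "continuous_on {a..b} p" and C: "\<forall>\<^sub>F x in F. continuous_on {a..b} (P x)"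
    and lim: "uniform_limit {a..b} P p F"
  shows "((\<lambda>x. pruefer_angle a b (P x)) \<longlongrightarrow> pruefer_angle a b p) F"
proof (rule tendstoI)
  fix e :: real assume "0 < e"
  obtain M where M: "0 \<le> M" "\<And>y. y \<in> {a..b} \<Longrightarrow> \<bar>p y - 1\<bar> \<le> M"
    by (rule continuous_on_Icc_bound[of a b "\<lambda>y. p y - 1"]) (auto intro: continuous_intros c)
  define B where "B = (b - a) * exp ((2 * M + 1) * (b - a))"
  have "0 \<le> B" using \<open>a \<le> b\<close> by (simp add: B_def)
  \<comment> \<open>Chosen so that \<open>d^2 * B < d^2 * (B + 1)^2 = e^2\<close>.\<close>
  define d where "d = e / (B + 1)"
  have "0 < d" using \<open>0 < e\<close> \<open>0 \<le> B\<close> by (simp add: d_def)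
  have dB: "d\<^sup>2 * B < e\<^sup>2"
  proof -
    have "(B + 1)\<^sup>2 - B = B\<^sup>2 + B + 1" by (simp add: power2_eq_square algebra_simps)
    then have "B < (B + 1)\<^sup>2" using \<open>0 \<le> B\<close> zero_le_power2[of B] by linarith
    then have "d\<^sup>2 * B < d\<^sup>2 * (B + 1)\<^sup>2" using \<open>0 < d\<close> by simp
    also have "\<dots> = (d * (B + 1))\<^sup>2" by (simp only: power_mult_distrib)
    also have "\<dots> = e\<^sup>2" using \<open>0 \<le> B\<close> by (simp add: d_def)
    finally show ?thesis .
  qed
  from C uniform_limitD[OF lim \<open>0 < d\<close>]
  show "\<forall>\<^sub>F x in F. dist (pruefer_angle a b (P x)) (pruefer_angle a b p) < e"
  proof eventually_elim
    case (elim x)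
    obtain \<theta> where \<theta>: "pruefer a b p \<theta>" "pruefer_angle a b p = \<theta> b"
      by (rule pruefer_angle_cases[OF \<open>a \<le> b\<close> c])
    obtain \<theta>' where \<theta>': "pruefer a b (P x) \<theta>'" "pruefer_angle a b (P x) = \<theta>' b"
      by (rule pruefer_angle_cases[OF \<open>a \<le> b\<close> elim(1)])
    have "(\<theta>' b - \<theta> b)\<^sup>2 \<le> d\<^sup>2 * (b - a) * exp ((2 * M + 1) * (b - a))"
      by (rule pruefer_lipschitz[OF \<open>a \<le> b\<close> \<theta>(1) \<theta>'(1) M(2)])
        (use elim(2) in \<open>auto simp: dist_real_def intro: less_imp_le\<close>)
    with dB have "\<bar>\<theta>' b - \<theta> b\<bar>\<^sup>2 < e\<^sup>2" by (simp add: B_def mult.assoc)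
    then have "\<bar>\<theta>' b - \<theta> b\<bar> < e" using \<open>0 < e\<close> by (rule power_less_imp_less_base[OF _ less_imp_le])
    then show ?case by (simp add: \<theta> \<theta>' dist_real_def)
  qed
qed

text \<open>Every eigenfunction is a nonzero multiple of \<open>r sin \<theta>\<close> with
  \<open>r > 0\<close>. Conversely \<open>r sin \<theta>\<close> is a nontrivial solution, because
  its slope at \<open>a\<close> is 1.\<close>

lemma dir_eigs_iff_sin:
  assumes "a < b" and q: "continuous_on {a..b} q" and pr: "pruefer a b (\<lambda>y. q y + \<mu>) \<theta>"
  shows "\<mu> \<in> dir_eigs a b q \<longleftrightarrow> sin (\<theta> b) = 0"
proof -
  have pc: "continuous_on {a..b} (\<lambda>y. q y + \<mu>)" by (intro continuous_intros q)
  obtain r where r: "r a = 1" "\<And>y. 0 < r y"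
    and sol: "schr_sol a b (\<lambda>y. q y + \<mu>) (\<lambda>y. r y * sin (\<theta> y)) (\<lambda>y. r y * cos (\<theta> y))"
    using pruefer_schr_sol[OF less_imp_le[OF \<open>a < b\<close>] pc pr] by blast
  note \<theta>a = prueferD(1)[OF pr]
  have b: "b \<in> {a..b}" and a: "a \<in> {a..b}" using \<open>a < b\<close> by auto
  show ?thesis
  proof
    assume "\<mu> \<in> dir_eigs a b q"
    then obtain \<phi> \<phi>1 \<phi>2 where \<phi>: "\<And>y. y \<in> {a..b} \<Longrightarrow> (\<phi> has_real_derivative \<phi>1 y) (at y within {a..b})
        \<and> (\<phi>1 has_real_derivative \<phi>2 y) (at y within {a..b}) \<and> - \<phi>2 y - q y * \<phi> y = \<mu> * \<phi> y"
      and bc: "\<phi> a = 0" "\<phi> b = 0" and nz: "\<exists>y\<in>{a..b}. \<phi> y \<noteq> 0"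
      unfolding dir_eigs_def by blast
    have "\<phi>2 y = - (q y + \<mu>) * \<phi> y" if "y \<in> {a..b}" for y
      using \<phi>[OF that] by (simp add: algebra_simps)
    then have "schr_sol a b (\<lambda>y. q y + \<mu>) \<phi> \<phi>1"
      unfolding schr_sol_def using \<phi> by auto
    from schr_sol_unique(1)[OF pc sol this] have eq: "\<phi> y = \<phi>1 a * (r y * sin (\<theta> y))" if "y \<in> {a..b}" for y
      using that r bc \<theta>a by simp
    from nz eq have "\<phi>1 a \<noteq> 0" by auto
    with eq[OF b] bc r(2)[of b] show "sin (\<theta> b) = 0" by simp
  next
    assume "sin (\<theta> b) = 0"
    have "\<exists>y\<in>{a..b}. r y * sin (\<theta> y) \<noteq> 0"
    proof (rule ccontr)
      assume *: "\<not> ?thesis"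
      have "r a * cos (\<theta> a) = 0"
        by (rule derivative_zero_within_Icc[OF \<open>a < b\<close> _ a schr_solD(1)[OF sol a]]) (use * in auto)
      then show False by (simp add: r \<theta>a)
    qed
    with \<open>sin (\<theta> b) = 0\<close> sol \<theta>a show "\<mu> \<in> dir_eigs a b q"
      unfolding dir_eigs_def schr_sol_def
      by (intro CollectI exI[of _ "\<lambda>y. r y * sin (\<theta> y)"] exI[of _ "\<lambda>y. r y * cos (\<theta> y)"]
           exI[of _ "\<lambda>y. - (q y + \<mu>) * (r y * sin (\<theta> y))"])
         (auto simp: algebra_simps)
  qed
qed

text \<open>A zero of the sine is an integer multiple of \<open>pi\<close>, and positivity of the
  angle leaves only the positive multiples.\<close>

lemma dir_eigs_iff_pruefer_angle:
  assumes "a < b" and q: "continuous_on {a..b} q"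
  shows "\<mu> \<in> dir_eigs a b q \<longleftrightarrow> (\<exists>n\<ge>1. pruefer_angle a b (\<lambda>y. q y + \<mu>) = real n * pi)"
proof -
  have pc: "continuous_on {a..b} (\<lambda>y. q y + \<mu>)" by (intro continuous_intros q)
  obtain \<theta> where \<theta>: "pruefer a b (\<lambda>y. q y + \<mu>) \<theta>" "pruefer_angle a b (\<lambda>y. q y + \<mu>) = \<theta> b"
    by (rule pruefer_angle_cases[OF less_imp_le[OF \<open>a < b\<close>] pc])
  have "0 < \<theta> b" by (rule pruefer_pos[OF \<open>a < b\<close> pc \<theta>(1)])
  have "sin (\<theta> b) = 0 \<longleftrightarrow> (\<exists>n\<ge>1. \<theta> b = real n * pi)"
  proof
    assume "sin (\<theta> b) = 0"
    then obtain i :: int where i: "\<theta> b = real_of_int i * pi" by (auto simp: sin_zero_iff_int2)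
    with \<open>0 < \<theta> b\<close> have "0 < i" by (simp add: zero_less_mult_iff)
    then show "\<exists>n\<ge>1. \<theta> b = real n * pi" using i by (intro exI[of _ "nat i"]) auto
  qed auto
  then show ?thesis using dir_eigs_iff_sin[OF assms \<theta>(1)] \<theta>(2) by simp
qed

lemma uniform_limit_of_tendsto:
  assumes "(f \<longlongrightarrow> l) F"
  shows "uniform_limit S (\<lambda>x y. f x) (\<lambda>y. l) F"
  by (rule uniform_limitI) (use tendstoD[OF assms] in \<open>auto elim: eventually_mono\<close>)

lemma pruefer_angle_isCont:
  assumes "a \<le> b" and q: "continuous_on {a..b} q"
  shows "isCont (\<lambda>\<nu>. pruefer_angle a b (\<lambda>y. q y + \<nu>)) \<nu>"
  unfolding isCont_def
proof (rule pruefer_angle_tendsto[OF \<open>a \<le> b\<close>])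
  show "uniform_limit {a..b} (\<lambda>\<nu> y. q y + \<nu>) (\<lambda>y. q y + \<nu>) (at \<nu>)"
    by (intro uniform_limit_add uniform_limit_const uniform_limit_of_tendsto tendsto_ident_at)
  show "\<forall>\<^sub>F \<nu> in at \<nu>. continuous_on {a..b} (\<lambda>y. q y + \<nu>)"
    by (intro always_eventually allI continuous_intros q)
qed (intro continuous_intros q)

text \<open>The angle is continuous and strictly increasing in the spectral parameter and starts
  below \<open>pi\<close>, so each lower level \<open>k * pi\<close> is attained exactly once. Hence
  precisely \<open>n - 1\<close> eigenvalues lie below the one at level
  \<open>n * pi\<close>.\<close>

lemma dir_eigval_eqI:
  assumes "a < b" and q: "continuous_on {a..b} q" and "1 \<le> n"
    and angle: "pruefer_angle a b (\<lambda>y. q y + \<mu>) = real n * pi"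
  shows "dir_eigval a b q n = \<mu>"
proof -
  let ?A = "\<lambda>\<nu>. pruefer_angle a b (\<lambda>y. q y + \<nu>)"
  have pc: "continuous_on {a..b} (\<lambda>y. q y + \<nu>)" for \<nu> by (intro continuous_intros q)
  have mono: "?A \<nu> < ?A \<nu>'" if "\<nu> < \<nu>'" for \<nu> \<nu>'
    by (rule pruefer_angle_strict_mono[OF \<open>a < b\<close> pc pc]) (use that in simp)
  have less_iff: "?A \<nu> < ?A \<nu>' \<longleftrightarrow> \<nu> < \<nu>'" for \<nu> \<nu>'
    using mono[of \<nu> \<nu>'] mono[of \<nu>' \<nu>] by (cases \<nu> \<nu>' rule: linorder_cases) auto
  have eq_iff: "?A \<nu> = ?A \<nu>' \<longleftrightarrow> \<nu> = \<nu>'" for \<nu> \<nu>'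
    using mono[of \<nu> \<nu>'] mono[of \<nu>' \<nu>] by (cases \<nu> \<nu>' rule: linorder_cases) auto
  have cont: "isCont ?A \<nu>" for \<nu>
    by (rule pruefer_angle_isCont[OF less_imp_le[OF \<open>a < b\<close>] q])
  obtain M where M: "\<And>y. y \<in> {a..b} \<Longrightarrow> \<bar>q y\<bar> \<le> M"
    using continuous_on_Icc_bound[OF q] by blast
  \<comment> \<open>With \<open>M\<close> a bound for \<open>|q|\<close>, the potential
    \<open>q - M\<close> is nonpositive and the barrier at \<open>pi / 2\<close> applies.\<close>
  have low: "?A (- M) \<le> pi / 2"
  proof -
    obtain \<theta> where \<theta>: "pruefer a b (\<lambda>y. q y + - M) \<theta>" "?A (- M) = \<theta> b"
      by (rule pruefer_angle_cases[OF less_imp_le[OF \<open>a < b\<close>] pc])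
    have "q y + - M \<le> 0" if "y \<in> {a..b}" for y
      using M[OF that] by linarith
    then have "\<theta> b \<le> pi / 2" using \<open>a < b\<close> by (intro pruefer_le_half_pi[OF _ \<theta>(1)]) auto
    then show ?thesis unfolding \<theta>(2) .
  qed
  \<comment> \<open>Stated for any level \<open>m\<close>, because the uniqueness half of the
    definite description applies it to a competing eigenvalue.\<close>
  have card: "card {\<nu> \<in> dir_eigs a b q. \<nu> < \<mu>'} = m - 1" if m: "1 \<le> m" "?A \<mu>' = real m * pi" for m \<mu>'
  proof -
    have "\<exists>\<nu>. ?A \<nu> = real k * pi" if "k \<in> {1..<m}" for k
    proof -
      have "pi / 2 \<le> real k * pi" using that by (intro order_trans[OF _ mult_right_mono[of 1 "real k"]]) auto
      with low have "?A (- M) \<le> real k * pi" by linarith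
      moreover have "real k * pi \<le> ?A \<mu>'" using that m by simp
      moreover have "- M \<le> \<mu>'" using calculation less_iff[of \<mu>' "- M"] by linarith
      ultimately show ?thesis
        using IVT[of ?A "- M" "real k * pi" \<mu>'] cont by blast
    qed
    then obtain g where g: "\<And>k. k \<in> {1..<m} \<Longrightarrow> ?A (g k) = real k * pi" by metis
    have "{\<nu> \<in> dir_eigs a b q. \<nu> < \<mu>'} = g ` {1..<m}"
    proof (intro equalityI subsetI)
      fix \<nu> assume "\<nu> \<in> {\<nu> \<in> dir_eigs a b q. \<nu> < \<mu>'}"
      then obtain k where k: "1 \<le> k" "?A \<nu> = real k * pi" and "\<nu> < \<mu>'"
        using dir_eigs_iff_pruefer_angle[OF \<open>a < b\<close> q] by auto
      then have "k < m" using less_iff[of \<nu> \<mu>'] m by simp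
      with k show "\<nu> \<in> g ` {1..<m}" using g[of k] eq_iff[of \<nu> "g k"] by auto
    next
      fix \<nu> assume "\<nu> \<in> g ` {1..<m}"
      then obtain k where k: "k \<in> {1..<m}" "\<nu> = g k" by auto
      then show "\<nu> \<in> {\<nu> \<in> dir_eigs a b q. \<nu> < \<mu>'}"
        using g[of k] m less_iff[of \<nu> \<mu>'] dir_eigs_iff_pruefer_angle[OF \<open>a < b\<close> q, of \<nu>] by auto
    qed
    moreover have "inj_on g {1..<m}"
      by (rule inj_onI) (metis g mult_cancel_right of_nat_eq_iff pi_neq_zero)
    ultimately show ?thesis by (simp add: card_image)
  qed
  show ?thesis unfolding dir_eigval_def
  proof (rule the_equality)
    show "\<mu> \<in> dir_eigs a b q \<and> card {\<nu> \<in> dir_eigs a b q. \<nu> < \<mu>} = n - 1"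
      using card[OF \<open>1 \<le> n\<close> angle] dir_eigs_iff_pruefer_angle[OF \<open>a < b\<close> q] angle \<open>1 \<le> n\<close> by blast
    fix ev assume ev: "ev \<in> dir_eigs a b q \<and> card {\<nu> \<in> dir_eigs a b q. \<nu> < ev} = n - 1"
    then obtain m where m: "1 \<le> m" "?A ev = real m * pi"
      using dir_eigs_iff_pruefer_angle[OF \<open>a < b\<close> q] by blast
    \<comment> \<open>Both indices are at least 1, so truncated subtraction loses nothing in
      \<open>m - 1 = n - 1\<close>.\<close>
    with card[OF m] ev \<open>1 \<le> n\<close> have "m = n" by simp
    with m angle eq_iff[of ev \<mu>] show "ev = \<mu>" by simp
  qed
qed

section \<open>Perturbation of Dirichlet eigenvalues\<close>

text \<open>The limiting angles at \<open>\<mu> - e\<close> and \<open>\<mu> + e\<close> lie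
  strictly on either side of \<open>n * pi\<close>, and eventually so do the perturbed ones. A
  parameter between them attains the level, and attaining it identifies the \<open>n\<close>-th
  eigenvalue.\<close>

lemma dir_eigval_perturbation:
  fixes q :: "'x \<Rightarrow> real \<Rightarrow> real"
  assumes "a < b" and q0: "continuous_on {a..b} q0" and qc: "\<forall>\<^sub>F x in F. continuous_on {a..b} (q x)"
    and lim: "uniform_limit {a..b} q q0 F" and "1 \<le> n"
    and angle: "pruefer_angle a b (\<lambda>y. q0 y + \<mu>) = real n * pi"
  shows "\<forall>\<^sub>F x in F. pruefer_angle a b (\<lambda>y. q x y + dir_eigval a b (q x) n) = real n * pi"
    and "((\<lambda>x. dir_eigval a b (q x) n) \<longlongrightarrow> \<mu>) F"
proof -
  let ?A = "\<lambda>q \<nu>. pruefer_angle a b (\<lambda>y. q y + \<nu>)"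
  have lim\<nu>: "((\<lambda>x. ?A (q x) \<nu>) \<longlongrightarrow> ?A q0 \<nu>) F" for \<nu>
  proof (rule pruefer_angle_tendsto)
    show "\<forall>\<^sub>F x in F. continuous_on {a..b} (\<lambda>y. q x y + \<nu>)"
      using qc by eventually_elim (intro continuous_intros)
    show "uniform_limit {a..b} (\<lambda>x y. q x y + \<nu>) (\<lambda>y. q0 y + \<nu>) F"
      by (intro uniform_limit_add lim uniform_limit_const)
  qed (use \<open>a < b\<close> q0 in \<open>auto intro!: continuous_intros\<close>)
  have mono: "?A q0 \<nu> < ?A q0 \<nu>'" if "\<nu> < \<nu>'" for \<nu> \<nu>'
    by (rule pruefer_angle_strict_mono[OF \<open>a < b\<close>]) (use that q0 in \<open>auto intro!: continuous_intros\<close>)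
  have key: "\<forall>\<^sub>F x in F. ?A (q x) (dir_eigval a b (q x) n) = real n * pi
      \<and> \<bar>dir_eigval a b (q x) n - \<mu>\<bar> \<le> e" if e: "0 < e" for e
  proof -
    have "?A q0 (\<mu> - e) < real n * pi" "real n * pi < ?A q0 (\<mu> + e)"
      using mono[of "\<mu> - e" \<mu>] mono[of \<mu> "\<mu> + e"] angle e by auto
    from qc order_tendstoD(2)[OF lim\<nu> this(1)] order_tendstoD(1)[OF lim\<nu> this(2)]
    show ?thesis
    proof eventually_elim
      case (elim x)
      then obtain \<nu> where \<nu>: "\<mu> - e \<le> \<nu>" "\<nu> \<le> \<mu> + e" "?A (q x) \<nu> = real n * pi"
        using IVT[of "?A (q x)" "\<mu> - e" "real n * pi" "\<mu> + e"] e
          pruefer_angle_isCont[OF less_imp_le[OF \<open>a < b\<close>] elim(1)] by auto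
      then have "dir_eigval a b (q x) n = \<nu>"
        using dir_eigval_eqI[OF \<open>a < b\<close> elim(1) \<open>1 \<le> n\<close>] by blast
      with \<nu> show ?case by auto
    qed
  qed
  show "\<forall>\<^sub>F x in F. ?A (q x) (dir_eigval a b (q x) n) = real n * pi"
    using key[OF zero_less_one] by eventually_elim auto
  show "((\<lambda>x. dir_eigval a b (q x) n) \<longlongrightarrow> \<mu>) F"
  proof (rule tendstoI)
    fix e :: real assume "0 < e"
    then have "0 < e / 2" by simp
    from key[OF this] show "\<forall>\<^sub>F x in F. dist (dir_eigval a b (q x) n) \<mu> < e"
      by eventually_elim (use \<open>0 < e\<close> in \<open>auto simp: dist_real_def\<close>)
  qed
qed

text \<open>The difference \<open>w x - u\<close> solves the perturbed equation with zero initial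
  data and the uniformly small forcing \<open>(p - P x) u\<close>, so the energy estimate
  applies.\<close>

lemma schr_sol_uniform_limit:
  assumes p: "continuous_on {a..b} p" and lim: "uniform_limit {a..b} P p F"
    and sol: "schr_sol a b p u v" and sols: "\<forall>\<^sub>F x in F. schr_sol a b (P x) (w x) (w' x)"
    and init: "\<forall>\<^sub>F x in F. w x a = u a \<and> w' x a = v a"
  shows "uniform_limit {a..b} w u F"
proof (rule uniform_limitI)
  fix e :: real assume "0 < e"
  obtain M where M: "\<And>y. y \<in> {a..b} \<Longrightarrow> \<bar>p y\<bar> \<le> M"
    using continuous_on_Icc_bound[OF p] by blast
  obtain N where N: "0 \<le> N" "\<And>y. y \<in> {a..b} \<Longrightarrow> \<bar>u y\<bar> \<le> N"
    using continuous_on_Icc_bound[OF schr_solD(3)[OF sol]] by blast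
  \<comment> \<open>The energy bound for potentials of size \<open>M + 1\<close> and forcing
    \<open>d * N\<close>, with \<open>d^2\<close> factored out; absolute values make it monotone and
    nonnegative without sign assumptions.\<close>
  define B where "B = \<bar>b - a\<bar> * exp (\<bar>M + 1 + 2\<bar> * \<bar>b - a\<bar>) * N\<^sup>2"
  have "0 \<le> B" by (simp add: B_def)
  \<comment> \<open>The cap 1 keeps the perturbed potentials below \<open>M + 1\<close>; the other
    entry yields \<open>d^2 * B < e^2\<close>.\<close>
  define d where "d = min 1 (e / (B + 1))"
  have "0 < d" using \<open>0 < e\<close> \<open>0 \<le> B\<close> by (simp add: d_def)
  have dB: "d\<^sup>2 * B < e\<^sup>2"
  proof -
    have "(B + 1)\<^sup>2 - B = B\<^sup>2 + B + 1" by (simp add: power2_eq_square algebra_simps)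
    then have "B < (B + 1)\<^sup>2" using \<open>0 \<le> B\<close> zero_le_power2[of B] by linarith
    then have "d\<^sup>2 * B < d\<^sup>2 * (B + 1)\<^sup>2" using \<open>0 < d\<close> by simp
    also have "\<dots> = (d * (B + 1))\<^sup>2" by (simp only: power_mult_distrib)
    also have "\<dots> \<le> e\<^sup>2"
    proof (rule power_mono)
      have "d \<le> e / (B + 1)" by (simp add: d_def)
      then show "d * (B + 1) \<le> e" using \<open>0 \<le> B\<close> by (simp add: pos_le_divide_eq)
    qed (use \<open>0 < d\<close> \<open>0 \<le> B\<close> in simp)
    finally show ?thesis .
  qed
  from sols init uniform_limitD[OF lim \<open>0 < d\<close>]
  show "\<forall>\<^sub>F x in F. \<forall>y\<in>{a..b}. dist (w x y) (u y) < e"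
  proof eventually_elim
    case (elim x)
    have close: "\<bar>P x y - p y\<bar> \<le> d" if "y \<in> {a..b}" for y
      using bspec[OF elim(3) that] by (simp add: dist_real_def)
    show ?case
    proof
      fix y assume y: "y \<in> {a..b}"
      have "(w x y - u y)\<^sup>2 + (w' x y - v y)\<^sup>2 \<le> (d * N)\<^sup>2 * (y - a) * exp ((M + 1 + 2) * (y - a))"
      proof (rule linear_system_bound[where p = "P x" and b = b and g = "\<lambda>y. (p y - P x y) * u y"])
        fix y assume y: "y \<in> {a..b}"
        show "((\<lambda>y. w x y - u y) has_real_derivative w' x y - v y) (at y within {a..b})"
          by (intro derivative_intros schr_solD(1)[OF sol y] schr_solD(1)[OF elim(1) y])
        show "((\<lambda>y. w' x y - v y) has_real_derivative - P x y * (w x y - u y) + (p y - P x y) * u y) (at y within {a..b})"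
          by (rule derivative_eq_intros schr_solD(2)[OF sol y] schr_solD(2)[OF elim(1) y])+
            (simp add: algebra_simps)
        show "\<bar>P x y\<bar> \<le> M + 1" using close[OF y] M[OF y] unfolding d_def by linarith
        have "\<bar>p y - P x y\<bar> * \<bar>u y\<bar> \<le> d * N"
          using close[OF y] N \<open>0 < d\<close> y by (intro mult_mono) auto
        then show "\<bar>(p y - P x y) * u y\<bar> \<le> d * N" by (simp add: abs_mult)
      qed (use elim y in auto)
      also have "\<dots> \<le> d\<^sup>2 * B"
      proof -
        have "(y - a) * exp ((M + 1 + 2) * (y - a)) \<le> \<bar>b - a\<bar> * exp (\<bar>M + 1 + 2\<bar> * \<bar>b - a\<bar>)"
        proof (intro mult_mono)
          have "(M + 1 + 2) * (y - a) \<le> \<bar>M + 1 + 2\<bar> * \<bar>b - a\<bar>"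
            using y by (intro mult_mono) auto
          then show "exp ((M + 1 + 2) * (y - a)) \<le> exp (\<bar>M + 1 + 2\<bar> * \<bar>b - a\<bar>)" by simp
        qed (use y in auto)
        then have "(d * N)\<^sup>2 * ((y - a) * exp ((M + 1 + 2) * (y - a)))
            \<le> (d * N)\<^sup>2 * (\<bar>b - a\<bar> * exp (\<bar>M + 1 + 2\<bar> * \<bar>b - a\<bar>))"
          by (rule mult_left_mono) simp
        then show ?thesis by (simp only: B_def power_mult_distrib mult_ac)
      qed
      finally have "\<bar>w x y - u y\<bar>\<^sup>2 < e\<^sup>2"
        using dB zero_le_power2[of "w' x y - v y"] unfolding power2_abs by linarith
      then have "\<bar>w x y - u y\<bar> < e" using \<open>0 < e\<close> by (rule power_less_imp_less_base[OF _ less_imp_le])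
      then show "dist (w x y) (u y) < e" by (simp add: dist_real_def)
    qed
  qed
qed

text \<open>The integrand is the derivative of the Wronskian \<open>u' w - u w'\<close>, whose
  boundary values vanish.\<close>

lemma wronskian_integral:
  assumes "a \<le> b" and s: "schr_sol a b p u v" and s': "schr_sol a b p' w w'"
    and "u a = 0" "u b = 0" "w a = 0" "w b = 0"
  shows "((\<lambda>y. (p' y - p y) * (u y * w y)) has_integral 0) {a..b}"
proof -
  have "((\<lambda>y. (p' y - p y) * (u y * w y)) has_integral (v b * w b - u b * w' b) - (v a * w a - u a * w' a)) {a..b}"
  proof (rule fundamental_theorem_of_calculus[OF \<open>a \<le> b\<close>])
    fix y assume y: "y \<in> {a..b}"
    show "((\<lambda>y. v y * w y - u y * w' y) has_vector_derivative (p' y - p y) * (u y * w y)) (at y within {a..b})"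
      unfolding has_real_derivative_iff_has_vector_derivative[symmetric]
      by (rule derivative_eq_intros schr_solD(1,2)[OF s y] schr_solD(1,2)[OF s' y] refl)+
        (simp add: algebra_simps)
  qed
  with assms show ?thesis by simp
qed

lemma tendsto_integral_of_uniform_limit:
  fixes f :: "'x \<Rightarrow> real \<Rightarrow> real"
  assumes lim: "uniform_limit {a..b} f g F" and c: "\<forall>\<^sub>F x in F. continuous_on {a..b} (f x)" and "F \<noteq> bot"
  shows "((\<lambda>x. integral {a..b} (f x)) \<longlongrightarrow> integral {a..b} g) F"
proof -
  \<comment> \<open>Continuity holds only eventually, while the limit theorem for integrals wants
    integrability at every index; the exceptional indices are reset to zero.\<close>
  define f' where "f' = (\<lambda>x. if continuous_on {a..b} (f x) then f x else (\<lambda>_. 0))"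
  have ev: "\<forall>\<^sub>F x in F. f' x = f x" using c by eventually_elim (simp add: f'_def)
  have "uniform_limit {a..b} f' g F \<longleftrightarrow> uniform_limit {a..b} f g F"
    by (rule uniform_limit_cong) (use ev in \<open>auto elim: eventually_mono\<close>)
  with lim have "uniform_limit {a..b} f' g F" by simp
  then obtain I J where I: "\<And>x. (f' x has_integral I x) {a..b}" "(g has_integral J) {a..b}" "(I \<longlongrightarrow> J) F"
    by (rule uniform_limit_integral) (auto simp: f'_def \<open>F \<noteq> bot\<close>)
  have "((\<lambda>x. integral {a..b} (f' x)) \<longlongrightarrow> integral {a..b} g) F"
    using I(3) by (simp add: integral_unique[OF I(1)] integral_unique[OF I(2)])
  then show ?thesis
    by (rule Lim_transform_eventually) (use ev in \<open>auto elim: eventually_mono\<close>)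
qed

text \<open>\<open>Q\<close> is the divided difference of the potential in \<open>c\<close>. The
  Wronskian identity for the eigenfunctions at \<open>c0\<close> and \<open>c\<close> expresses the
  difference quotient of the eigenvalue as a ratio of integrals, and both converge since the
  eigenfunctions converge uniformly.\<close>

lemma dir_eigval_has_derivative:
  fixes q Q :: "real \<Rightarrow> real \<Rightarrow> real"
  assumes "a < b" and q0: "continuous_on {a..b} (q c0)" and qc: "\<forall>\<^sub>F c in at c0. continuous_on {a..b} (q c)"
    and Q0: "continuous_on {a..b} Q0" and Qc: "\<forall>\<^sub>F c in at c0. continuous_on {a..b} (Q c)"
    and Q: "\<forall>\<^sub>F c in at c0. \<forall>y\<in>{a..b}. q c y - q c0 y = (c - c0) * Q c y"
    and Qlim: "uniform_limit {a..b} Q Q0 (at c0)"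
    and "1 \<le> n" and angle: "pruefer_angle a b (\<lambda>y. q c0 y + \<mu>) = real n * pi"
    and sol: "schr_sol a b (\<lambda>y. q c0 y + \<mu>) u v" and u: "u a = 0" "v a = 1"
    and norm: "integral {a..b} (\<lambda>y. (u y)\<^sup>2) \<noteq> 0"
  shows "((\<lambda>c. dir_eigval a b (q c) n) has_real_derivative
      - integral {a..b} (\<lambda>y. Q0 y * (u y)\<^sup>2) / integral {a..b} (\<lambda>y. (u y)\<^sup>2)) (at c0)"
proof -
  define l where "l = (\<lambda>c. dir_eigval a b (q c) n)"
  have le: "a \<le> b" using \<open>a < b\<close> by simp
  have bd: "bounded (f ` {a..b})" if "continuous_on {a..b} f" for f :: "real \<Rightarrow> real"
    by (intro compact_imp_bounded compact_continuous_image that compact_Icc)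
  have uc: "continuous_on {a..b} u" by (rule schr_solD(3)[OF sol])
  have p0: "continuous_on {a..b} (\<lambda>y. q c0 y + \<mu>)" by (intro continuous_intros q0)
  \<comment> \<open>Near \<open>c0\<close> the potential is \<open>q c0 + (c - c0) * Q c\<close>,
    and the second summand tends to zero uniformly.\<close>
  have qlim: "uniform_limit {a..b} q (q c0) (at c0)"
  proof -
    have "((\<lambda>c. c - c0) \<longlongrightarrow> c0 - c0) (at c0)" by (intro tendsto_intros)
    from uniform_lim_mult[OF uniform_limit_of_tendsto[OF this] Qlim _ bd[OF Q0]]
    have "uniform_limit {a..b} (\<lambda>c y. q c0 y + (c - c0) * Q c y) (\<lambda>y. q c0 y + (c0 - c0) * Q0 y) (at c0)"
      by (intro uniform_limit_add uniform_limit_const) (auto simp: image_constant_conv)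
    moreover have "uniform_limit {a..b} (\<lambda>c y. q c0 y + (c - c0) * Q c y) (\<lambda>y. q c0 y + (c0 - c0) * Q0 y) (at c0)
        \<longleftrightarrow> uniform_limit {a..b} q (q c0) (at c0)"
      by (rule uniform_limit_cong) (use Q in \<open>auto elim!: eventually_mono\<close>)
    ultimately show ?thesis by simp
  qed
  have pert: "\<forall>\<^sub>F c in at c0. pruefer_angle a b (\<lambda>y. q c y + l c) = real n * pi" "(l \<longlongrightarrow> \<mu>) (at c0)"
    unfolding l_def by (rule dir_eigval_perturbation[OF \<open>a < b\<close> q0 qc qlim \<open>1 \<le> n\<close> angle])+
  \<comment> \<open>An angle \<open>n * pi\<close> makes every solution that starts at zero vanish
    at \<open>b\<close>, hence an eigenfunction if it is nontrivial.\<close>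
  have sin_end: "u' b = 0" if prem: "continuous_on {a..b} p" "pruefer_angle a b p = real n * pi"
      "schr_sol a b p u' v'" "u' a = 0" for p u' v'
  proof -
    obtain \<theta> where \<theta>: "pruefer a b p \<theta>" "pruefer_angle a b p = \<theta> b"
      by (rule pruefer_angle_cases[OF le prem(1)])
    obtain r where r: "r a = 1" "\<And>y. 0 < r y"
        "schr_sol a b p (\<lambda>y. r y * sin (\<theta> y)) (\<lambda>y. r y * cos (\<theta> y))"
      using pruefer_schr_sol[OF le prem(1) \<theta>(1)] by blast
    have "u' b = v' a * (r b * sin (\<theta> b))"
      by (rule schr_sol_unique(1)[OF prem(1) r(3) prem(3)]) (use r prueferD(1)[OF \<theta>(1)] prem le in auto)
    moreover have "sin (\<theta> b) = 0" using \<theta>(2) prem(2) sin_npi[of n] by simp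
    ultimately show ?thesis by simp
  qed
  \<comment> \<open>The eigenfunctions at nearby \<open>c\<close> are normalized by the initial
    slope 1, as \<open>u\<close> is; equal initial data are what makes them converge to
    \<open>u\<close>.\<close>
  define R where "R = (\<lambda>c w w'. schr_sol a b (\<lambda>y. q c y + l c) w w' \<and> w a = 0 \<and> w' a = 1)"
  define w where "w = (\<lambda>c. SOME w. \<exists>w'. R c w w')"
  define w' where "w' = (\<lambda>c. SOME w'. R c (w c) w')"
  have R_some: "R c (w c) (w' c)" if "\<exists>w w'. R c w w'" for c
  proof -
    have "\<exists>w'. R c (w c) w'" unfolding w_def by (rule someI_ex[OF that])
    then show ?thesis unfolding w'_def by (rule someI_ex)
  qed
  have ev: "\<forall>\<^sub>F c in at c0. R c (w c) (w' c)"
    using qc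
  proof eventually_elim
    case (elim c)
    then have c: "continuous_on {a..b} (\<lambda>y. q c y + l c)" by (intro continuous_intros)
    obtain \<theta> where \<theta>: "pruefer a b (\<lambda>y. q c y + l c) \<theta>" using pruefer_exists[OF le c] by blast
    obtain r where "r a = 1" "schr_sol a b (\<lambda>y. q c y + l c) (\<lambda>y. r y * sin (\<theta> y)) (\<lambda>y. r y * cos (\<theta> y))"
      using pruefer_schr_sol[OF le c \<theta>] by blast
    then show ?case using prueferD(1)[OF \<theta>]
      by (intro R_some exI[of _ "\<lambda>y. r y * sin (\<theta> y)"] exI[of _ "\<lambda>y. r y * cos (\<theta> y)"]) (auto simp: R_def)
  qed
  have wlim: "uniform_limit {a..b} w u (at c0)"
  proof (rule schr_sol_uniform_limit[OF p0 _ sol])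
    show "uniform_limit {a..b} (\<lambda>c y. q c y + l c) (\<lambda>y. q c0 y + \<mu>) (at c0)"
      by (intro uniform_limit_add qlim uniform_limit_of_tendsto pert(2))
    show "\<forall>\<^sub>F c in at c0. schr_sol a b (\<lambda>y. q c y + l c) (w c) (w' c)"
      "\<forall>\<^sub>F c in at c0. w c a = u a \<and> w' c a = v a"
      using ev u by (auto simp: R_def elim: eventually_mono)
  qed
  have wc: "\<forall>\<^sub>F c in at c0. continuous_on {a..b} (w c)"
    using ev by eventually_elim (auto simp: R_def intro: schr_solD(3))
  have uw: "uniform_limit {a..b} (\<lambda>c y. u y * w c y) (\<lambda>y. u y * u y) (at c0)"
    by (intro uniform_lim_mult uniform_limit_const wlim bd uc)
  have lim1: "((\<lambda>c. integral {a..b} (\<lambda>y. u y * w c y)) \<longlongrightarrow> integral {a..b} (\<lambda>y. u y * u y)) (at c0)"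
    by (rule tendsto_integral_of_uniform_limit[OF uw])
      (use wc in \<open>auto elim!: eventually_mono intro!: continuous_intros uc\<close>)
  have lim2: "((\<lambda>c. integral {a..b} (\<lambda>y. Q c y * (u y * w c y))) \<longlongrightarrow> integral {a..b} (\<lambda>y. Q0 y * (u y * u y))) (at c0)"
  proof (rule tendsto_integral_of_uniform_limit)
    show "uniform_limit {a..b} (\<lambda>c y. Q c y * (u y * w c y)) (\<lambda>y. Q0 y * (u y * u y)) (at c0)"
      by (intro uniform_lim_mult Qlim uw bd Q0 continuous_intros uc)
    show "\<forall>\<^sub>F c in at c0. continuous_on {a..b} (\<lambda>y. Q c y * (u y * w c y))"
      using Qc wc by eventually_elim (intro continuous_intros uc)
  qed simp
  have norm': "integral {a..b} (\<lambda>y. u y * u y) \<noteq> 0" using norm by (simp add: power2_eq_square)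
  have l0: "l c0 = \<mu>" unfolding l_def by (rule dir_eigval_eqI[OF \<open>a < b\<close> q0 \<open>1 \<le> n\<close> angle])
  \<comment> \<open>Division is legitimate near \<open>c0\<close>: the integral of
    \<open>u * w c\<close> tends to that of \<open>u^2\<close>, which is nonzero, and
    \<open>c\<close> differs from \<open>c0\<close>.\<close>
  have "\<forall>\<^sub>F c in at c0. - integral {a..b} (\<lambda>y. Q c y * (u y * w c y)) / integral {a..b} (\<lambda>y. u y * w c y)
      = (l c - l c0) / (c - c0)"
    using ev qc Qc wc Q pert(1) tendsto_imp_eventually_ne[OF lim1 norm'] eventually_neq_at_within[of c0 c0 UNIV]
  proof eventually_elim
    case (elim c)
    let ?I = "integral {a..b} (\<lambda>y. u y * w c y)" and ?J = "integral {a..b} (\<lambda>y. Q c y * (u y * w c y))"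
    have pc: "continuous_on {a..b} (\<lambda>y. q c y + l c)" by (intro continuous_intros elim)
    have sw: "schr_sol a b (\<lambda>y. q c y + l c) (w c) (w' c)" "w c a = 0" using elim(1) by (auto simp: R_def)
    have "((\<lambda>y. (q c y + l c - (q c0 y + \<mu>)) * (u y * w c y)) has_integral 0) {a..b}"
      by (rule wronskian_integral[OF le sol sw(1) u(1) sin_end[OF p0 angle sol u(1)] sw(2)
            sin_end[OF pc elim(6) sw]])
    moreover have "((\<lambda>y. (q c y + l c - (q c0 y + \<mu>)) * (u y * w c y)) has_integral ((c - c0) * ?J + (l c - \<mu>) * ?I)) {a..b}"
    proof (rule has_integral_eq)
      show "((\<lambda>y. (c - c0) * (Q c y * (u y * w c y)) + (l c - \<mu>) * (u y * w c y)) has_integral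
          ((c - c0) * ?J + (l c - \<mu>) * ?I)) {a..b}"
        by (intro has_integral_add has_integral_mult_right integrable_integral
              integrable_continuous_interval continuous_intros uc elim)
      fix y assume "y \<in> {a..b}"
      with elim(5) have "q c y - q c0 y = (c - c0) * Q c y" by blast
      then have "q c y + l c - (q c0 y + \<mu>) = (c - c0) * Q c y + (l c - \<mu>)" by linarith
      then show "(c - c0) * (Q c y * (u y * w c y)) + (l c - \<mu>) * (u y * w c y)
          = (q c y + l c - (q c0 y + \<mu>)) * (u y * w c y)" by (simp only: distrib_right mult.assoc)
    qed
    ultimately have "(c - c0) * ?J + (l c - \<mu>) * ?I = 0" by (rule has_integral_unique[symmetric])
    then have "- ?J * (c - c0) = (l c - l c0) * ?I" unfolding l0 by (simp add: algebra_simps)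
    moreover have "?I \<noteq> 0" "c - c0 \<noteq> 0" using elim(7,8) by auto
    ultimately show ?case by (metis frac_eq_eq)
  qed
  moreover have "((\<lambda>c. - integral {a..b} (\<lambda>y. Q c y * (u y * w c y)) / integral {a..b} (\<lambda>y. u y * w c y))
      \<longlongrightarrow> - integral {a..b} (\<lambda>y. Q0 y * (u y * u y)) / integral {a..b} (\<lambda>y. u y * u y)) (at c0)"
    by (intro tendsto_intros lim1 lim2 norm')
  ultimately show ?thesis
    unfolding has_field_derivative_iff l_def[symmetric] power2_eq_square
    by (rule Lim_transform_eventually[rotated])
qed

section \<open>Non-resonant neutral modes\<close>

text \<open>An eigenvalue needs an angle of at least \<open>pi\<close>, but a nonpositive potential
  keeps it at most \<open>pi / 2\<close>.\<close>

lemma not_in_dir_eigs: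
  assumes "a < b" and q: "continuous_on {a..b} q" and "\<And>y. y \<in> {a..b} \<Longrightarrow> q y + \<mu> \<le> 0"
  shows "\<mu> \<notin> dir_eigs a b q"
proof
  assume "\<mu> \<in> dir_eigs a b q"
  then obtain n where n: "1 \<le> n" "pruefer_angle a b (\<lambda>y. q y + \<mu>) = real n * pi"
    using dir_eigs_iff_pruefer_angle[OF \<open>a < b\<close> q] by blast
  have pc: "continuous_on {a..b} (\<lambda>y. q y + \<mu>)" by (intro continuous_intros q)
  obtain \<theta> where \<theta>: "pruefer a b (\<lambda>y. q y + \<mu>) \<theta>" "pruefer_angle a b (\<lambda>y. q y + \<mu>) = \<theta> b"
    by (rule pruefer_angle_cases[OF less_imp_le[OF \<open>a < b\<close>] pc])
  have "\<theta> b \<le> pi / 2"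
    by (rule pruefer_le_half_pi[OF less_imp_le[OF \<open>a < b\<close>] \<theta>(1) assms(3)])
  moreover have "1 * pi \<le> real n * pi" using n(1) by (intro mult_right_mono) auto
  ultimately have "pi \<le> pi / 2" using n(2) \<theta>(2) by linarith
  then show False using pi_gt_zero by linarith
qed

text \<open>Evaluates the definite description of the Dirichlet inverse at a known solution.
  Uniqueness holds because a nonzero difference of two solutions would make 0 an eigenvalue for the
  negative constant potential \<open>- \<alpha>^2\<close>.\<close>

lemma dir_inv_eq:
  assumes "a < b"
    and \<phi>: "\<And>y. y \<in> {a..b} \<Longrightarrow> (\<phi> has_vector_derivative \<phi>1 y) (at y within {a..b})"
    and \<phi>1: "\<And>y. y \<in> {a..b} \<Longrightarrow> (\<phi>1 has_vector_derivative \<phi>2 y) (at y within {a..b})"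
    and f: "\<And>y. y \<in> {a..b} \<Longrightarrow> f y = - \<phi>2 y + complex_of_real (\<alpha>\<^sup>2) * \<phi> y"
    and bc: "\<phi> a = 0" "\<phi> b = 0" and y: "y \<in> {a..b}"
  shows "dir_inv a b \<alpha> f y = \<phi> y"
proof -
  \<comment> \<open>The inverse is pinned to 0 outside the interval, while \<open>\<phi>\<close> is
    arbitrary there.\<close>
  define \<psi> where "\<psi> = (\<lambda>y. if y \<in> {a..b} then \<phi> y else 0)"
  have "dir_inv a b \<alpha> f = \<psi>"
    unfolding dir_inv_def
  proof (rule the_equality)
    have "(\<psi> has_vector_derivative \<phi>1 y) (at y within {a..b})" if "y \<in> {a..b}" for y
      by (rule has_vector_derivative_transform_within[OF \<phi>[OF that] zero_less_one that]) (simp add: \<psi>_def)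
    then have "\<forall>y\<in>{a..b}. (\<psi> has_vector_derivative \<phi>1 y) (at y within {a..b})
        \<and> (\<phi>1 has_vector_derivative \<phi>2 y) (at y within {a..b})
        \<and> - \<phi>2 y + complex_of_real (\<alpha>\<^sup>2) * \<psi> y = f y"
      using \<phi>1 f by (simp add: \<psi>_def)
    then show "(\<exists>u1 u2. \<forall>y\<in>{a..b}. (\<psi> has_vector_derivative u1 y) (at y within {a..b})
          \<and> (u1 has_vector_derivative u2 y) (at y within {a..b})
          \<and> - u2 y + complex_of_real (\<alpha>\<^sup>2) * \<psi> y = f y)
        \<and> \<psi> a = 0 \<and> \<psi> b = 0 \<and> (\<forall>y. y \<notin> {a..b} \<longrightarrow> \<psi> y = 0)"
      using bc by (auto simp: \<psi>_def)
  next
    fix u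
    assume "(\<exists>u1 u2. \<forall>y\<in>{a..b}. (u has_vector_derivative u1 y) (at y within {a..b})
          \<and> (u1 has_vector_derivative u2 y) (at y within {a..b})
          \<and> - u2 y + complex_of_real (\<alpha>\<^sup>2) * u y = f y)
        \<and> u a = 0 \<and> u b = 0 \<and> (\<forall>y. y \<notin> {a..b} \<longrightarrow> u y = 0)"
    then obtain u1 u2 where u: "\<And>y. y \<in> {a..b} \<Longrightarrow> (u has_vector_derivative u1 y) (at y within {a..b})"
        "\<And>y. y \<in> {a..b} \<Longrightarrow> (u1 has_vector_derivative u2 y) (at y within {a..b})"
        "\<And>y. y \<in> {a..b} \<Longrightarrow> - u2 y + complex_of_real (\<alpha>\<^sup>2) * u y = f y"
      and ubc: "u a = 0" "u b = 0" "\<And>y. y \<notin> {a..b} \<Longrightarrow> u y = 0"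
      by blast
    \<comment> \<open>Here \<open>h\<close> stands for \<open>Re\<close> or \<open>Im\<close>: the
      complex problem splits into two real ones, to which the eigenvalue facts apply.\<close>
    have proj: "h (u y - \<phi> y) = 0"
      if h: "bounded_linear h" and hc: "\<And>r z. h (complex_of_real r * z) = r * h z" and y: "y \<in> {a..b}"
      for h :: "complex \<Rightarrow> real" and y
    proof (rule ccontr)
      interpret h: bounded_linear h by (rule h)
      assume nz: "h (u y - \<phi> y) \<noteq> 0"
      have d1: "((\<lambda>y. h (u y - \<phi> y)) has_real_derivative h (u1 y - \<phi>1 y)) (at y within {a..b})" if "y \<in> {a..b}" for y
        unfolding has_real_derivative_iff_has_vector_derivative
        by (intro h.has_vector_derivative has_vector_derivative_diff \<phi> u that)
      have d2: "((\<lambda>y. h (u1 y - \<phi>1 y)) has_real_derivative h (u2 y - \<phi>2 y)) (at y within {a..b})" if "y \<in> {a..b}" for y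
        unfolding has_real_derivative_iff_has_vector_derivative
        by (intro h.has_vector_derivative has_vector_derivative_diff \<phi>1 u that)
      have eq: "- h (u2 y - \<phi>2 y) - (- \<alpha>\<^sup>2) * h (u y - \<phi> y) = 0 * h (u y - \<phi> y)" if "y \<in> {a..b}" for y
      proof -
        have "u2 y - \<phi>2 y = complex_of_real (\<alpha>\<^sup>2) * (u y - \<phi> y)"
          using u(3)[OF that] f[OF that] by (simp add: algebra_simps)
        then show ?thesis using hc[of "\<alpha>\<^sup>2" "u y - \<phi> y"] by simp
      qed
      have nz': "\<exists>y\<in>{a..b}. h (u y - \<phi> y) \<noteq> 0" using nz y by blast
      have "0 \<in> dir_eigs a b (\<lambda>_. - \<alpha>\<^sup>2)"
        unfolding dir_eigs_def
        by (intro CollectI exI[of _ "\<lambda>y. h (u y - \<phi> y)"] exI[of _ "\<lambda>y. h (u1 y - \<phi>1 y)"]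
            exI[of _ "\<lambda>y. h (u2 y - \<phi>2 y)"] conjI ballI d1 d2 eq nz')
          (use bc ubc h.zero in auto)
      then show False using not_in_dir_eigs[OF \<open>a < b\<close>, of "\<lambda>_. - \<alpha>\<^sup>2" 0] by simp
    qed
    show "u = \<psi>"
    proof
      fix y
      have "Re (u y - \<phi> y) = 0" "Im (u y - \<phi> y) = 0" if "y \<in> {a..b}"
        using proj[OF bounded_linear_Re _ that] proj[OF bounded_linear_Im _ that] by auto
      then show "u y = \<psi> y" using ubc(3)[of y] by (auto simp: \<psi>_def complex_eq_iff)
    qed
  qed
  with y show ?thesis by (simp add: \<psi>_def)
qed

text \<open>Supplies what the derivative formula asks of the potentials \<open>g / (U - c')\<close>.
  The range of \<open>U\<close> is compact and misses \<open>c\<close>, so denominators stay nonzero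
  for \<open>c'\<close> near \<open>c\<close>, and the divided difference in \<open>c\<close> is
  explicit.\<close>

lemma quotient_perturbation:
  fixes g U :: "real \<Rightarrow> real"
  assumes g: "continuous_on {a..b} g" and U: "continuous_on {a..b} U" and c: "c \<notin> U ` {a..b}"
  shows "continuous_on {a..b} (\<lambda>y. g y / (U y - c))"
    and "\<forall>\<^sub>F c' in at c. continuous_on {a..b} (\<lambda>y. g y / (U y - c'))"
    and "continuous_on {a..b} (\<lambda>y. g y / ((U y - c) * (U y - c)))"
    and "\<forall>\<^sub>F c' in at c. continuous_on {a..b} (\<lambda>y. g y / ((U y - c') * (U y - c)))"
    and "\<forall>\<^sub>F c' in at c. \<forall>y\<in>{a..b}. g y / (U y - c') - g y / (U y - c) = (c' - c) * (g y / ((U y - c') * (U y - c)))"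
    and "uniform_limit {a..b} (\<lambda>c' y. g y / ((U y - c') * (U y - c))) (\<lambda>y. g y / ((U y - c) * (U y - c))) (at c)"
proof -
  have ne: "U y - c \<noteq> 0" if "y \<in> {a..b}" for y using c that by auto
  have frac_diff: "w / x - w / z = (z - x) * (w / (x * z))" if "x \<noteq> 0" "z \<noteq> 0" for w x z :: real
    using that by (simp add: field_simps)
  have comp: "compact (U ` {a..b})" by (intro compact_continuous_image U compact_Icc)
  then have "open (- (U ` {a..b}))" by (simp add: compact_imp_closed open_Compl)
  with c have ev: "\<forall>\<^sub>F c' in at c. \<forall>y\<in>{a..b}. U y - c' \<noteq> 0"
    by (auto simp: eventually_at_topological)
  \<comment> \<open>The distance from \<open>c\<close> to the range of \<open>U\<close>;
    \<open>d * d\<close> then bounds the limiting denominator away from zero.\<close>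
  obtain d where d: "0 < d" "\<And>x. x \<in> U ` {a..b} \<Longrightarrow> d \<le> dist c x"
    using separate_point_closed[OF compact_imp_closed[OF comp] c] by blast
  have bd: "bounded (f ` {a..b})" if "continuous_on {a..b} f" for f :: "real \<Rightarrow> real"
    by (intro compact_imp_bounded compact_continuous_image that compact_Icc)
  show "continuous_on {a..b} (\<lambda>y. g y / (U y - c))"
    by (intro continuous_intros g U ballI ne)
  show "continuous_on {a..b} (\<lambda>y. g y / ((U y - c) * (U y - c)))"
    by (intro continuous_intros g U ballI) (use ne in auto)
  show "\<forall>\<^sub>F c' in at c. continuous_on {a..b} (\<lambda>y. g y / (U y - c'))"
    using ev by eventually_elim (intro continuous_intros g U)
  show "\<forall>\<^sub>F c' in at c. continuous_on {a..b} (\<lambda>y. g y / ((U y - c') * (U y - c)))"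
    using ev by eventually_elim (intro continuous_intros g U, use ne in auto)
  show "\<forall>\<^sub>F c' in at c. \<forall>y\<in>{a..b}. g y / (U y - c') - g y / (U y - c) = (c' - c) * (g y / ((U y - c') * (U y - c)))"
    using ev
  proof eventually_elim
    case (elim c')
    show ?case
    proof
      fix y assume y: "y \<in> {a..b}"
      have "U y - c' \<noteq> 0" using elim y by blast
      with ne[OF y] show "g y / (U y - c') - g y / (U y - c) = (c' - c) * (g y / ((U y - c') * (U y - c)))"
        using frac_diff[of "U y - c'" "U y - c" "g y"] by simp
    qed
  qed
  show "uniform_limit {a..b} (\<lambda>c' y. g y / ((U y - c') * (U y - c))) (\<lambda>y. g y / ((U y - c) * (U y - c))) (at c)"
  proof (rule uniform_lim_divide[where b = "d * d"])
    show "uniform_limit {a..b} (\<lambda>c' y. (U y - c') * (U y - c)) (\<lambda>y. (U y - c) * (U y - c)) (at c)"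
      by (intro uniform_lim_mult uniform_limit_minus uniform_limit_const uniform_limit_of_tendsto
          tendsto_ident_at bd continuous_intros U)
    fix y assume "y \<in> {a..b}"
    then have "d \<le> \<bar>U y - c\<bar>" using d(2)[of "U y"] by (simp add: dist_real_def)
    then show "d * d \<le> norm ((U y - c) * (U y - c))"
      using d(1) by (simp only: real_norm_def abs_mult) (intro mult_mono, auto)
  qed (use d(1) in \<open>auto intro: uniform_limit_const bd g\<close>)
qed

theorem theorem3p2:
  fixes y1 y2 \<alpha> \<beta> c Ub :: real
    and U U1 U2 U3 K :: "real \<Rightarrow> real"
    and \<phi> \<phi>1 \<phi>2 :: "real \<Rightarrow> complex"
  assumes hU: "class_Kplus y1 y2 U U1 U2 U3"
    and h\<beta>: "\<beta> \<in> {Inf (U2 ` {y1..y2}) <..< Sup (U2 ` {y1..y2})}"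
    and hK: "Kplus_witness y1 y2 U U2 \<beta> Ub K"
    and hc: "c \<notin> U ` {y1..y2}"
    and h\<alpha>: "\<alpha> > 0"
    and h\<phi>: "\<forall>y\<in>{y1..y2}. (\<phi> has_vector_derivative \<phi>1 y) (at y within {y1..y2})
                 \<and> (\<phi>1 has_vector_derivative \<phi>2 y) (at y within {y1..y2})
                 \<and> - \<phi>2 y + complex_of_real (\<alpha>\<^sup>2) * \<phi> y
                     - complex_of_real ((\<beta> - U2 y) / (U y - c)) * \<phi> y = 0"
    and hbc: "\<phi> y1 = 0" "\<phi> y2 = 0"
    and hnontriv: "\<exists>y\<in>{y1..y2}. \<phi> y \<noteq> 0"
    and hnorm: "integral {y1..y2} (\<lambda>y. (cmod (\<phi> y))\<^sup>2) = 1"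
  shows "\<exists>n0::nat. n0 \<ge> 1 \<and> \<alpha>\<^sup>2 = - lam y1 y2 U U2 n0 \<beta> c \<and> - lam y1 y2 U U2 n0 \<beta> c > 0
           \<and> (\<exists>D. ((\<lambda>c'. lam y1 y2 U U2 n0 \<beta> c') has_real_derivative D) (at c)
                 \<and> ip y1 y2 (L_op y1 y2 K \<alpha> (\<lambda>y. - \<phi>2 y + complex_of_real (\<alpha>\<^sup>2) * \<phi> y))
                           (\<lambda>y. - \<phi>2 y + complex_of_real (\<alpha>\<^sup>2) * \<phi> y)
                   = complex_of_real (- (c - Ub) * D))"
proof -
  let ?I = "{y1..y2}"
  define q where "q = (\<lambda>c y. (\<beta> - U2 y) / (U y - c))"
  define Q where "Q = (\<lambda>c' y. (\<beta> - U2 y) / ((U y - c') * (U y - c)))"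
  have lt: "y1 < y2" and C3: "C3_on y1 y2 U U1 U2 U3" using hU by (auto simp: class_Kplus_def)
  have Uc: "continuous_on ?I U"
    by (rule DERIV_continuous_on[of _ _ U1]) (use C3 in \<open>auto simp: C3_on_def\<close>)
  have U2c: "continuous_on ?I U2"
    by (rule DERIV_continuous_on[of _ _ U3]) (use C3 in \<open>auto simp: C3_on_def\<close>)
  have gc: "continuous_on ?I (\<lambda>y. \<beta> - U2 y)" by (intro continuous_intros U2c)
  note qQ = quotient_perturbation[OF gc Uc hc, folded q_def Q_def]
  have qc: "continuous_on ?I (q c)" using qQ(1) by (simp add: q_def)
  \<comment> \<open>The mode solves \<open>\<phi>'' = - p \<phi>\<close>, so
    \<open>- \<alpha>^2\<close> is the spectral parameter of the potential
    \<open>q c\<close>.\<close>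
  define p where "p = (\<lambda>y. q c y + - \<alpha>\<^sup>2)"
  have pc: "continuous_on ?I p" unfolding p_def by (intro continuous_intros qc)
  have d0: "(\<phi> has_vector_derivative \<phi>1 y) (at y within ?I)"
    and d1: "(\<phi>1 has_vector_derivative \<phi>2 y) (at y within ?I)"
    and ode: "\<phi>2 y = complex_of_real (- p y) * \<phi> y" if "y \<in> ?I" for y
    using bspec[OF h\<phi> that] by (auto simp: p_def q_def algebra_simps)
  have sols: "schr_sol y1 y2 p (\<lambda>y. h (\<phi> y)) (\<lambda>y. h (\<phi>1 y))"
    if h: "bounded_linear h" and hc: "\<And>r z. h (complex_of_real r * z) = r * h z" for h :: "complex \<Rightarrow> real"
    unfolding schr_sol_def
  proof (intro ballI conjI)
    interpret h: bounded_linear h by (rule h)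
    fix y assume y: "y \<in> ?I"
    show "((\<lambda>y. h (\<phi> y)) has_real_derivative h (\<phi>1 y)) (at y within ?I)"
      unfolding has_real_derivative_iff_has_vector_derivative
      by (intro h.has_vector_derivative d0 y)
    have "h (\<phi>2 y) = - p y * h (\<phi> y)" unfolding ode[OF y] by (rule hc)
    moreover have "((\<lambda>y. h (\<phi>1 y)) has_real_derivative h (\<phi>2 y)) (at y within ?I)"
      unfolding has_real_derivative_iff_has_vector_derivative
      by (intro h.has_vector_derivative d1 y)
    ultimately show "((\<lambda>y. h (\<phi>1 y)) has_real_derivative - p y * h (\<phi> y)) (at y within ?I)" by simp
  qed
  obtain \<theta> where \<theta>: "pruefer y1 y2 p \<theta>" "pruefer_angle y1 y2 p = \<theta> y2"
    by (rule pruefer_angle_cases[OF less_imp_le[OF lt] pc])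
  obtain r where r: "r y1 = 1" "\<And>y. 0 < r y"
    "schr_sol y1 y2 p (\<lambda>y. r y * sin (\<theta> y)) (\<lambda>y. r y * cos (\<theta> y))"
    using pruefer_schr_sol[OF less_imp_le[OF lt] pc \<theta>(1)] by blast
  define u where "u = (\<lambda>y. r y * sin (\<theta> y))"
  define v where "v = (\<lambda>y. r y * cos (\<theta> y))"
  have sol: "schr_sol y1 y2 p u v" and u0: "u y1 = 0" "v y1 = 1"
    using r prueferD(1)[OF \<theta>(1)] by (auto simp: u_def v_def)
  \<comment> \<open>Real and imaginary parts of the mode are both multiples of the real solution
    \<open>u\<close>, so \<open>\<phi>\<close> is \<open>u\<close> times this complex slope.\<close>
  define k where "k = \<phi>1 y1"
  have \<phi>u: "\<phi> y = k * complex_of_real (u y)" if "y \<in> ?I" for y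
    using schr_sol_unique(1)[OF pc sol sols[OF bounded_linear_Re] u0 _ that]
      schr_sol_unique(1)[OF pc sol sols[OF bounded_linear_Im] u0 _ that] hbc(1)
    by (simp add: complex_eq_iff k_def)
  have "k \<noteq> 0" using hnontriv \<phi>u by auto
  have "u y2 = 0" using \<phi>u[of y2] hbc(2) lt \<open>k \<noteq> 0\<close> by simp
  then have "sin (\<theta> y2) = 0" using r(2)[of y2] by (simp add: u_def)
  then have "- \<alpha>\<^sup>2 \<in> dir_eigs y1 y2 (q c)"
    using dir_eigs_iff_sin[OF lt qc, of "- \<alpha>\<^sup>2"] \<theta>(1) by (simp add: p_def)
  then obtain n0 where n0: "1 \<le> n0" "pruefer_angle y1 y2 (\<lambda>y. q c y + - \<alpha>\<^sup>2) = real n0 * pi"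
    using dir_eigs_iff_pruefer_angle[OF lt qc] by blast
  have lam: "lam y1 y2 U U2 n0 \<beta> c' = dir_eigval y1 y2 (q c') n0" for c'
    by (simp add: lam_def q_def)
  have lam_c: "lam y1 y2 U U2 n0 \<beta> c = - \<alpha>\<^sup>2"
    unfolding lam by (rule dir_eigval_eqI[OF lt qc n0])
  let ?N = "integral ?I (\<lambda>y. (u y)\<^sup>2)" and ?J = "integral ?I (\<lambda>y. Q c y * (u y)\<^sup>2)"
  have cm: "(cmod (\<phi> y))\<^sup>2 = (cmod k)\<^sup>2 * (u y)\<^sup>2" if "y \<in> ?I" for y
    by (simp add: \<phi>u[OF that] norm_mult power_mult_distrib)
  have "integral ?I (\<lambda>y. (cmod (\<phi> y))\<^sup>2) = integral ?I (\<lambda>y. (cmod k)\<^sup>2 * (u y)\<^sup>2)"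
    by (rule integral_cong) (rule cm)
  with hnorm have N: "(cmod k)\<^sup>2 * ?N = 1" by simp
  then have "?N \<noteq> 0" by auto
  \<comment> \<open>\<open>Q c\<close> is \<open>(\<beta> - U'') / (U - c)^2\<close>, the derivative
    of the potential in \<open>c\<close>. Since \<open>u\<close> is normalized by its slope, its
    squared norm \<open>?N\<close> appears in the denominator.\<close>
  have D: "((\<lambda>c'. lam y1 y2 U U2 n0 \<beta> c') has_real_derivative - ?J / ?N) (at c)"
    unfolding lam
    by (rule dir_eigval_has_derivative[where q = q and Q = Q and v = v and \<mu> = "- \<alpha>\<^sup>2", OF lt qc _ _ _ _ _ n0])
      (use qQ sol u0 \<open>?N \<noteq> 0\<close> in \<open>simp_all add: q_def Q_def p_def\<close>)
  let ?w = "\<lambda>y. - \<phi>2 y + complex_of_real (\<alpha>\<^sup>2) * \<phi> y"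
  have "ip y1 y2 (L_op y1 y2 K \<alpha> ?w) ?w = complex_of_real ((c - Ub) * (cmod k)\<^sup>2 * ?J)"
    unfolding ip_def
  proof (rule integral_unique, rule has_integral_eq)
    have "continuous_on ?I (Q c)" using qQ(3) by (simp add: Q_def)
    then have "((\<lambda>y. (c - Ub) * (cmod k)\<^sup>2 * (Q c y * (u y)\<^sup>2)) has_integral (c - Ub) * (cmod k)\<^sup>2 * ?J) ?I"
      by (intro has_integral_mult_right integrable_integral integrable_continuous_interval
          continuous_intros schr_solD(3)[OF sol])
    from has_integral_linear[OF this bounded_linear_of_real]
    show "((\<lambda>y. complex_of_real ((c - Ub) * (cmod k)\<^sup>2 * (Q c y * (u y)\<^sup>2))) has_integral
        complex_of_real ((c - Ub) * (cmod k)\<^sup>2 * ?J)) ?I" by (simp add: o_def)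
    fix y assume y: "y \<in> ?I"
    have w: "?w y = complex_of_real (q c y) * \<phi> y"
      by (simp add: ode[OF y] p_def algebra_simps)
    have inv: "dir_inv y1 y2 \<alpha> ?w y = \<phi> y"
      by (rule dir_inv_eq[OF lt d0 d1 refl hbc y])
    have Ky: "0 < K y" "\<beta> - U2 y = K y * (U y - Ub)" using hK y by (auto simp: Kplus_witness_def)
    have ne: "U y - c \<noteq> 0" using hc y by auto
    have "q c y = K y * ((U y - Ub) / (U y - c))" "Q c y = K y * ((U y - Ub) / (U y - c)) / (U y - c)"
      by (simp_all add: q_def Q_def Ky(2))
    \<comment> \<open>This is the origin of the factor \<open>c - Ub\<close>. By the equation
      \<open>\<omega> = q c * \<phi>\<close>, and \<open>q c / K\<close> equals this quotient;
      subtracting the 1 that comes from the Dirichlet inverse leaves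
      \<open>(c - Ub) / (U - c)\<close>.\<close>
    moreover have "(U y - Ub) / (U y - c) = 1 + (c - Ub) / (U y - c)"
      using ne by (simp add: field_simps)
    ultimately have coef: "(q c y / K y - 1) * q c y = (c - Ub) * Q c y"
      using Ky(1) by simp
    have "L_op y1 y2 K \<alpha> ?w y * cnj (?w y)
        = complex_of_real ((q c y / K y - 1) * q c y) * (\<phi> y * cnj (\<phi> y))"
      unfolding L_op_def inv w by (simp add: algebra_simps)
    also have "\<dots> = complex_of_real ((c - Ub) * Q c y) * complex_of_real ((cmod k)\<^sup>2 * (u y)\<^sup>2)"
      unfolding coef complex_norm_square[symmetric] cm[OF y, symmetric] ..
    finally show "complex_of_real ((c - Ub) * (cmod k)\<^sup>2 * (Q c y * (u y)\<^sup>2))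
        = L_op y1 y2 K \<alpha> ?w y * cnj (?w y)"
      by (simp add: mult_ac)
  qed
  \<comment> \<open>The unit norm of \<open>\<phi>\<close> says that \<open>|k|^2\<close> is the
    reciprocal of \<open>?N\<close>, matching the denominator of the derivative.\<close>
  also have "(c - Ub) * (cmod k)\<^sup>2 * ?J = - (c - Ub) * (- ?J / ?N)"
  proof -
    have "(cmod k)\<^sup>2 = 1 / ?N" using N \<open>?N \<noteq> 0\<close> by (simp add: nonzero_eq_divide_eq)
    then show ?thesis by (simp add: algebra_simps diff_divide_distrib)
  qed
  finally show ?thesis
    using n0(1) lam_c h\<alpha> D by (intro exI[of _ n0] conjI exI[of _ "- ?J / ?N"]) auto
qed

end
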